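(* Let $F$ be a field of characteristic $2$, let $k,m,n\ge1$ be integers, and let $\psi_1$ be an $(m+k)$-fold quadratic Pfister form and $\psi_2$ an $(n+k)$-fold quadratic Pfister form over $F$ which are (separably) $k$-linked. Then: (1) If $\psi_1$ and $\psi_2$ are also inseparably $k$-linked, then $\mathcal{F}_k(\psi_1,\psi_2)$ is hyperbolic. (2) If $\mathcal{F}_k(\psi_1,\psi_2)$ is hyperbolic, and $m=1$ or $n=1$ (that is, at least one of the two forms is a $(k+1)$-fold Pfister form), then $\psi_1$ and $\psi_2$ are inseparably $k$-linked.
   Context: $F$ is a field of characteristic $2$; equality of forms means isometry. For $a\in F^\times$, $\langle\langle a\rangle\rangle$ denotes the symmetric bilinear form $\langle 1,-a\rangle$ (here $-1=1$), and an $r$-fold bilinear Pfister form is $\langle\langle a_1,\dots,a_r\rangle\rangle=\langle\langle a_1\rangle\rangle\otimes\cdots\otimes\langle\langle a_r\rangle\rangle$ with $a_i\in F^\times$ (the $0$-fold one is $\langle1\rangle$). For a diagonal bilinear form $B=\langle b_1,\dots,b_s\rangle$ and a quadratic form $q$, $B\otimes q=b_1q\perp\cdots\perp b_sq$. For $r\ge1$, an $r$-fold quadratic Pfister form is $\langle\langle\alpha_1,\dots,\alpha_{r-1},\alpha_r]]=\langle\langle\alpha_1,\dots,\alpha_{r-1}\rangle\rangle\otimes[1,\alpha_r]$ with $\alpha_1,\dots,\alpha_{r-1}\in F^\times$, $\alpha_r\in F$, where $[1,\alpha]$ is the quadratic form $x^2+xy+\alpha y^2$. Quadratic Pfister forms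 $\psi_1,\psi_2$ are (separably) $k$-linked if there are a $k$-fold quadratic Pfister form $\pi$ and bilinear Pfister forms $B_1,B_2$ with $\psi_1=B_1\otimes\pi$, $\psi_2=B_2\otimes\pi$. They are inseparably $k$-linked if there are a $k$-fold bilinear Pfister form $B$ and quadratic Pfister forms $\pi_1,\pi_2$ with $\psi_1=B\otimes\pi_1$, $\psi_2=B\otimes\pi_2$. For (separably) $k$-linked $\psi_1,\psi_2$, the $k$-invariant is the quadratic Pfister form $\mathcal{F}_k(\psi_1,\psi_2)=\varphi_1\otimes\varphi_2\otimes\pi$, where $\pi$ is any $k$-fold quadratic Pfister form and $\varphi_1,\varphi_2$ any bilinear Pfister forms with $\psi_1=\varphi_1\otimes\pi$, $\psi_2=\varphi_2\otimes\pi$; up to isometry it does not depend on these choices. The invariant is called trivial when it is hyperbolic. *)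

theory Defs
  imports "Jordan_Normal_Form.Matrix" "HOL-Computational_Algebra.Computational_Algebra"
begin

text \<open>
  A quadratic form in \<open>n\<close> variables is given by a coefficient matrix \<open>A\<close> of size \<open>n \<times> n\<close>, as
  the map \<open>x \<mapsto> \<Sum>i j. A\<^sub>i\<^sub>j x\<^sub>i x\<^sub>j\<close>. The matrix is not required to be symmetric (in
  characteristic 2, symmetric matrices would not give all quadratic forms), and different matrices
  may give the same form; \<open>isometric\<close> compares values only. The orthogonal sum of forms
  is the block diagonal matrix \<open>diag_block_mat\<close>.
\<close>

definition qf_value :: "'a::field mat \<Rightarrow> 'a vec \<Rightarrow> 'a" where
  "qf_value A x = x \<bullet> (A *\<^sub>v x)"

definition isometric :: "'a::field mat \<Rightarrow> 'a mat \<Rightarrow> bool" where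
  "isometric A B \<longleftrightarrow> (\<exists>n. A \<in> carrier_mat n n \<and> B \<in> carrier_mat n n \<and>
     (\<exists>P \<in> carrier_mat n n. invertible_mat P \<and>
        (\<forall>x \<in> carrier_vec n. qf_value B (P *\<^sub>v x) = qf_value A x)))"

text \<open>The form \<open>[a, b]\<close>, that is \<open>a x\<^sup>2 + x y + b y\<^sup>2\<close>.\<close>

definition binary_qf :: "'a::field \<Rightarrow> 'a \<Rightarrow> 'a mat" where
  "binary_qf a b = mat_of_rows_list 2 [[a, 1], [0, b]]"

definition hyperbolic :: "'a::field mat \<Rightarrow> bool" where
  "hyperbolic A \<longleftrightarrow> (\<exists>r. isometric A (diag_block_mat (replicate r (binary_qf 0 0))))"

text \<open>
  A list \<open>[b\<^sub>1, \<dots>, b\<^sub>s]\<close> of scalars stands for the diagonal bilinear form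
  \<open>\<langle>b\<^sub>1, \<dots>, b\<^sub>s\<rangle>\<close>.
\<close>

definition bil_tensor :: "'a::field list \<Rightarrow> 'a list \<Rightarrow> 'a list" where
  "bil_tensor B C = concat (map (\<lambda>b. map (\<lambda>c. b * c) C) B)"

definition bil_tensor_qf :: "'a::field list \<Rightarrow> 'a mat \<Rightarrow> 'a mat" where
  "bil_tensor_qf B A = diag_block_mat (map (\<lambda>b. b \<cdot>\<^sub>m A) B)"

fun bil_pfister_form :: "'a::field list \<Rightarrow> 'a list" where
  "bil_pfister_form [] = [1]"
| "bil_pfister_form (a # as) = bil_tensor [1, - a] (bil_pfister_form as)"

text \<open>
  Bilinear Pfister forms are taken here in their diagonal presentation and not up to isometry.
  They are only used as left factors of a tensor product with a quadratic form, whose isometry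
  class does not change if the bilinear form is replaced by an isometric one.
\<close>

definition bil_pfister :: "nat \<Rightarrow> 'a::field list \<Rightarrow> bool" where
  "bil_pfister r B \<longleftrightarrow> (\<exists>as. length as = r \<and> 0 \<notin> set as \<and> B = bil_pfister_form as)"

text \<open>Since \<open>r = Suc (length as)\<close>, this is false for \<open>r = 0\<close>.\<close>

definition quad_pfister :: "nat \<Rightarrow> 'a::field mat \<Rightarrow> bool" where
  "quad_pfister r A \<longleftrightarrow> (\<exists>as c. r = Suc (length as) \<and> 0 \<notin> set as \<and>
     isometric A (bil_tensor_qf (bil_pfister_form as) (binary_qf 1 c)))"

definition separably_linked :: "nat \<Rightarrow> 'a::field mat \<Rightarrow> 'a mat \<Rightarrow> bool" where
  "separably_linked k \<psi>\<^sub>1 \<psi>\<^sub>2 \<longleftrightarrow> (\<exists>\<pi> r\<^sub>1 r\<^sub>2 B\<^sub>1 B\<^sub>2. quad_pfister k \<pi> \<and>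
     bil_pfister r\<^sub>1 B\<^sub>1 \<and> bil_pfister r\<^sub>2 B\<^sub>2 \<and>
     isometric \<psi>\<^sub>1 (bil_tensor_qf B\<^sub>1 \<pi>) \<and> isometric \<psi>\<^sub>2 (bil_tensor_qf B\<^sub>2 \<pi>))"

definition inseparably_linked :: "nat \<Rightarrow> 'a::field mat \<Rightarrow> 'a mat \<Rightarrow> bool" where
  "inseparably_linked k \<psi>\<^sub>1 \<psi>\<^sub>2 \<longleftrightarrow> (\<exists>B r\<^sub>1 r\<^sub>2 \<pi>\<^sub>1 \<pi>\<^sub>2. bil_pfister k B \<and>
     quad_pfister r\<^sub>1 \<pi>\<^sub>1 \<and> quad_pfister r\<^sub>2 \<pi>\<^sub>2 \<and>
     isometric \<psi>\<^sub>1 (bil_tensor_qf B \<pi>\<^sub>1) \<and> isometric \<psi>\<^sub>2 (bil_tensor_qf B \<pi>\<^sub>2))"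

text \<open>
  The \<open>k\<close>-invariant of separably \<open>k\<close>-linked forms is determined only up to isometry, so it is given
  as a relation: \<open>is_k_invariant k \<psi>\<^sub>1 \<psi>\<^sub>2 \<chi>\<close> says that \<open>\<chi>\<close> is a form isometric to
  \<open>\<phi>\<^sub>1 \<otimes> \<phi>\<^sub>2 \<otimes> \<pi>\<close> for some admissible choice of \<open>\<phi>\<^sub>1\<close>, \<open>\<phi>\<^sub>2\<close>, \<open>\<pi>\<close>. Such a
  \<open>\<chi>\<close> exists if and only if the forms are separably \<open>k\<close>-linked.
\<close>

definition is_k_invariant :: "nat \<Rightarrow> 'a::field mat \<Rightarrow> 'a mat \<Rightarrow> 'a mat \<Rightarrow> bool" where
  "is_k_invariant k \<psi>\<^sub>1 \<psi>\<^sub>2 \<chi> \<longleftrightarrow> (\<exists>\<pi> r\<^sub>1 r\<^sub>2 \<phi>\<^sub>1 \<phi>\<^sub>2. quad_pfister k \<pi> \<and>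
     bil_pfister r\<^sub>1 \<phi>\<^sub>1 \<and> bil_pfister r\<^sub>2 \<phi>\<^sub>2 \<and>
     isometric \<psi>\<^sub>1 (bil_tensor_qf \<phi>\<^sub>1 \<pi>) \<and> isometric \<psi>\<^sub>2 (bil_tensor_qf \<phi>\<^sub>2 \<pi>) \<and>
     isometric \<chi> (bil_tensor_qf (bil_tensor \<phi>\<^sub>1 \<phi>\<^sub>2) \<pi>))"

end

theory Submission
  imports Defs "Jordan_Normal_Form.Determinant"
begin

text \<open>
  Write \<open>\<langle>\<langle>a\<rangle>\<rangle>A\<close> for \<open>A \<perp> aA\<close>. Since \<open>-1 = 1\<close>, both forms and their invariant arise from a plane
  \<open>[1,d]\<close> by iterating this doubling: there is \<open>P = \<langle>\<langle>c\<^sub>1,\<dots>,c\<^sub>k\<^sub>-\<^sub>1,d]]\<close>, of dimension \<open>2\<^sup>k\<close>, such that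
  \<open>\<psi>\<^sub>1\<close> is \<open>P\<close> doubled along a list \<open>as\<close>, \<open>\<psi>\<^sub>2\<close> is \<open>P\<close> doubled along a list \<open>bs\<close>, and the invariant is
  \<open>P\<close> doubled along both. Two classical properties of such forms are used throughout: they are
  round, that is, isometric to their multiple by any nonzero value that they represent
  (\<open>round_pfs\<close>), and therefore hyperbolic as soon as they are isotropic
  (\<open>isotropic_pfs_imp_hyperbolic\<close>). So hyperbolicity of the invariant can be tested on a single
  isotropic vector.

  Inseparable linkage implies a hyperbolic invariant (\<open>inseparable_linkage_isotropic\<close>).
  Let \<open>B = \<langle>\<langle>e\<^sub>1,\<dots>,e\<^sub>k\<rangle>\<rangle>\<close> be the common bilinear factor. The form \<open>T(x) = B(x,x)\<close> has dimension
  \<open>2\<^sup>k = dim P\<close>, is a subform of both \<open>\<psi>\<^sub>1\<close> and \<open>\<psi>\<^sub>2\<close>, and is additive in characteristic 2. Hence the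
  diagonal of \<open>T \<perp> T\<close> is a totally isotropic subspace of \<open>\<psi>\<^sub>1 \<perp> \<psi>\<^sub>2\<close> that is orthogonal to all of
  \<open>T \<perp> T\<close>. As \<open>P\<close> and \<open>T\<close> both represent 1, it can be enlarged by one dimension inside
  \<open>P \<perp> \<psi>\<^sub>1 \<perp> \<psi>\<^sub>2\<close>. Writing \<open>\<psi>\<^sub>i = P \<perp> R\<^sub>i\<close>, this sum is \<open>(P \<perp> P) \<perp> (P \<perp> R\<^sub>1 \<perp> R\<^sub>2)\<close>, where \<open>P \<perp> P\<close> is a sum
  of only \<open>2\<^sup>k\<close> hyperbolic planes. Splitting off one hyperbolic plane costs a totally isotropic
  subspace at most one dimension (\<open>zero_embeds_cancel_plane\<close>), so \<open>P \<perp> R\<^sub>1 \<perp> R\<^sub>2\<close> is isotropic. It is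
  a subform of the invariant.

  A hyperbolic invariant implies inseparable linkage if \<open>as\<close> or \<open>bs\<close> has length one
  (\<open>inseparably_linked_of_isotropic\<close>).
  Let \<open>\<psi>\<^sub>1 = \<langle>\<langle>a\<rangle>\<rangle>P\<close>. Isotropy of \<open>\<langle>\<langle>a\<rangle>\<rangle>\<psi>\<^sub>2\<close> means that \<open>\<psi>\<^sub>2 = P \<perp> R\<^sub>2\<close> represents \<open>a\<close>, say \<open>a = u + w\<close> with
  \<open>u\<close> a value of \<open>P\<close> and \<open>w\<close> a value of \<open>R\<^sub>2\<close>; and a nonzero value of \<open>R\<^sub>2\<close> can be made a slot of \<open>\<psi>\<^sub>2\<close>
  (\<open>represents_pfs_pure_slot\<close>). If \<open>u\<close> and \<open>w\<close> are nonzero, roundness allows division by \<open>u\<close>: with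
  \<open>z = w/u\<close>, \<open>\<psi>\<^sub>1 = \<langle>\<langle>1+z\<rangle>\<rangle>P\<close> and \<open>\<psi>\<^sub>2\<close> has the slot \<open>z\<close>. The isometry
  \<open>\<langle>\<langle>z,d]] = \<langle>\<langle>1+z, d+d/z]]\<close> (\<open>dbl_binary_shift\<close>) replaces this slot by \<open>1+z\<close>, so that
  \<open>\<langle>\<langle>1+z,c\<^sub>1,\<dots>,c\<^sub>k\<^sub>-\<^sub>1\<rangle>\<rangle>\<close> is a common bilinear factor. If \<open>u = 0\<close> the slots already agree, and if
  \<open>w = 0\<close> then \<open>\<psi>\<^sub>1\<close> is hyperbolic and thus a multiple of every \<open>k\<close>-fold bilinear Pfister form.
\<close>

section \<open>Orthogonal sums\<close>

definition orth_sum :: "'a::zero mat \<Rightarrow> 'a mat \<Rightarrow> 'a mat" (infixr \<open>\<perp>\<close> 65) where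
  "A \<perp> B = four_block_mat A (0\<^sub>m (dim_row A) (dim_col B)) (0\<^sub>m (dim_row B) (dim_col A)) B"

lemma orth_sum_dim [simp]:
  "dim_row (A \<perp> B) = dim_row A + dim_row B" "dim_col (A \<perp> B) = dim_col A + dim_col B"
  by (auto simp: orth_sum_def)

lemma orth_sum_carrier [simp, intro]:
  "A \<in> carrier_mat n n \<Longrightarrow> B \<in> carrier_mat m m \<Longrightarrow> A \<perp> B \<in> carrier_mat (n + m) (n + m)"
  by (auto simp: orth_sum_def)

lemma orth_sum_assoc: "(A \<perp> B) \<perp> C = A \<perp> B \<perp> C"
  unfolding orth_sum_def by (rule assoc_four_block_mat [symmetric])

lemma diag_block_mat_Cons: "diag_block_mat (A # As) = A \<perp> diag_block_mat As"
  by (simp add: orth_sum_def Let_def)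

lemma diag_block_mat_append_orth_sum:
  "diag_block_mat (As @ Bs) = diag_block_mat As \<perp> diag_block_mat Bs"
  by (simp add: orth_sum_def diag_block_mat_append Let_def)

lemma orth_sum_empty [simp]:
  "0\<^sub>m 0 0 \<perp> A = A" "A \<perp> 0\<^sub>m 0 0 = A"
  by (rule eq_matI; auto simp: orth_sum_def)+

lemma smult_orth_sum: "c \<cdot>\<^sub>m (A \<perp> B) = (c \<cdot>\<^sub>m A) \<perp> (c \<cdot>\<^sub>m (B :: 'a::field mat))"
  by (rule eq_matI) (auto simp: orth_sum_def)

lemma smult_smult_mat: "a \<cdot>\<^sub>m (b \<cdot>\<^sub>m A) = (a * b) \<cdot>\<^sub>m (A :: 'a::field mat)"
  by (rule eq_matI) (auto simp: mult.assoc)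

lemma one_smult_mat [simp]: "1 \<cdot>\<^sub>m A = (A :: 'a::field mat)"
  by (rule eq_matI) auto

lemma smult_mat_mult_vec:
  "A \<in> carrier_mat n m \<Longrightarrow> x \<in> carrier_vec m \<Longrightarrow> (c \<cdot>\<^sub>m A) *\<^sub>v x = c \<cdot>\<^sub>v (A *\<^sub>v (x :: 'a::field vec))"
  by (rule eq_vecI) (auto simp: scalar_prod_def sum_distrib_left mult.assoc intro!: sum.cong)

lemma zero_mat_mult_vec [simp]: "x \<in> carrier_vec m \<Longrightarrow> 0\<^sub>m n m *\<^sub>v x = 0\<^sub>v n"
  by (rule eq_vecI) (auto simp: scalar_prod_def)

lemma mult_mat_zero_vec [simp]: "A \<in> carrier_mat n m \<Longrightarrow> A *\<^sub>v 0\<^sub>v m = 0\<^sub>v n"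
  by (rule eq_vecI) (auto simp: scalar_prod_def)

lemma vec_append_cases:
  assumes "x \<in> carrier_vec (n + m)"
  obtains x1 x2 where "x = x1 @\<^sub>v x2" "x1 \<in> carrier_vec n" "x2 \<in> carrier_vec m"
  using assms by (metis vec_first_last_append vec_first_carrier vec_last_carrier)

lemma zero_vec_append: "x \<in> carrier_vec n \<Longrightarrow> x @\<^sub>v y = 0\<^sub>v (n + m) \<longleftrightarrow> x = 0\<^sub>v n \<and> y = 0\<^sub>v m"
proof -
  assume x: "x \<in> carrier_vec n"
  have "0\<^sub>v (n + m) = 0\<^sub>v n @\<^sub>v (0\<^sub>v m :: 'a vec)"
    by (rule eq_vecI) auto
  then show ?thesis
    using append_vec_eq [OF x zero_carrier_vec] by auto
qed

lemma qf_value_orth_sum: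
  assumes "A \<in> carrier_mat n n" "B \<in> carrier_mat m m" "x \<in> carrier_vec n" "y \<in> carrier_vec m"
  shows "qf_value (A \<perp> B) (x @\<^sub>v y) = qf_value A x + qf_value B y"
proof -
  have "(A \<perp> B) *\<^sub>v (x @\<^sub>v y) = (A *\<^sub>v x) @\<^sub>v (B *\<^sub>v y)"
    using mult_mat_vec_split [OF assms] assms by (simp add: orth_sum_def)
  then show ?thesis
    using assms by (simp add: qf_value_def scalar_prod_append [of _ n _ m])
qed

lemma qf_value_smult:
  assumes "A \<in> carrier_mat n n" "x \<in> carrier_vec n"
  shows "qf_value (c \<cdot>\<^sub>m A) x = c * qf_value A x"
  using assms by (simp add: qf_value_def smult_mat_mult_vec [of _ n n] mult_mat_vec[of _ n n])

definition polar :: "'a::field mat \<Rightarrow> 'a vec \<Rightarrow> 'a vec \<Rightarrow> 'a" where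
  "polar A x y = x \<bullet> (A *\<^sub>v y) + y \<bullet> (A *\<^sub>v x)"

lemma qf_value_lin:
  assumes "A \<in> carrier_mat n n" "x \<in> carrier_vec n" "y \<in> carrier_vec n"
  shows "qf_value A (x + c \<cdot>\<^sub>v y) = qf_value A x + c * polar A x y + c\<^sup>2 * qf_value A y"
  using assms
  by (simp add: qf_value_def polar_def mult_add_distrib_mat_vec [of _ n n]
      scalar_prod_add_distrib [of _ n] add_scalar_prod_distrib [of _ n] mult_mat_vec [of _ n n]
      algebra_simps power2_eq_square)

lemma qf_value_smult_vec:
  assumes "A \<in> carrier_mat n n" "x \<in> carrier_vec n"
  shows "qf_value A (c \<cdot>\<^sub>v x) = c\<^sup>2 * qf_value A x"
  using assms by (simp add: qf_value_def mult_mat_vec [of _ n n] power2_eq_square mult.assoc)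

section \<open>Embeddings and isometries\<close>

text \<open>
  Asking only for an injective map makes sums and multiples of embeddings immediate, and an
  embedding between forms of equal dimension is an isometry (\<open>isometric_iff_embeds\<close>). Totally
  isotropic subspaces are covered as well: one of dimension \<open>d\<close> in \<open>A\<close> is an embedding
  \<open>0\<^sub>m d d \<lesssim> A\<close>.
\<close>

definition embeds :: "'a::field mat \<Rightarrow> 'a mat \<Rightarrow> bool" (infix \<open>\<lesssim>\<close> 50) where
  "A \<lesssim> B \<longleftrightarrow> (\<exists>n m. A \<in> carrier_mat n n \<and> B \<in> carrier_mat m m \<and>
     (\<exists>P \<in> carrier_mat m n. (\<forall>x \<in> carrier_vec n. P *\<^sub>v x = 0\<^sub>v m \<longrightarrow> x = 0\<^sub>v n) \<and>
        (\<forall>x \<in> carrier_vec n. qf_value B (P *\<^sub>v x) = qf_value A x)))"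

abbreviation isom (infix \<open>\<simeq>\<close> 50) where "A \<simeq> B \<equiv> isometric A B"

lemma embedsI:
  assumes "A \<in> carrier_mat n n" "B \<in> carrier_mat m m" "P \<in> carrier_mat m n"
    and "\<And>x. x \<in> carrier_vec n \<Longrightarrow> P *\<^sub>v x = 0\<^sub>v m \<Longrightarrow> x = 0\<^sub>v n"
    and "\<And>x. x \<in> carrier_vec n \<Longrightarrow> qf_value B (P *\<^sub>v x) = qf_value A x"
  shows "A \<lesssim> B"
  using assms unfolding embeds_def by blast

lemma embedsE:
  assumes "A \<lesssim> B"
  obtains n m P where "A \<in> carrier_mat n n" "B \<in> carrier_mat m m" "P \<in> carrier_mat m n"
    and "\<And>x. x \<in> carrier_vec n \<Longrightarrow> P *\<^sub>v x = 0\<^sub>v m \<Longrightarrow> x = 0\<^sub>v n"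
    and "\<And>x. x \<in> carrier_vec n \<Longrightarrow> qf_value B (P *\<^sub>v x) = qf_value A x"
  using assms unfolding embeds_def by blast

lemma embeds_refl: "A \<in> carrier_mat n n \<Longrightarrow> A \<lesssim> A"
  by (rule embedsI [of _ n _ n "1\<^sub>m n"]) auto

lemma embeds_trans [trans]:
  assumes "A \<lesssim> B" "B \<lesssim> C"
  shows "A \<lesssim> C"
proof -
  obtain n m P where A: "A \<in> carrier_mat n n" "B \<in> carrier_mat m m" "P \<in> carrier_mat m n"
    "\<And>x. x \<in> carrier_vec n \<Longrightarrow> P *\<^sub>v x = 0\<^sub>v m \<Longrightarrow> x = 0\<^sub>v n"
    "\<And>x. x \<in> carrier_vec n \<Longrightarrow> qf_value B (P *\<^sub>v x) = qf_value A x"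
    using assms(1) by (rule embedsE) blast
  obtain m' k Q where B: "B \<in> carrier_mat m' m'" "C \<in> carrier_mat k k" "Q \<in> carrier_mat k m'"
    "\<And>x. x \<in> carrier_vec m' \<Longrightarrow> Q *\<^sub>v x = 0\<^sub>v k \<Longrightarrow> x = 0\<^sub>v m'"
    "\<And>x. x \<in> carrier_vec m' \<Longrightarrow> qf_value C (Q *\<^sub>v x) = qf_value B x"
    using assms(2) by (rule embedsE) blast
  have [simp]: "m' = m"
    using A(2) B(1) by auto
  show ?thesis
  proof (rule embedsI [of _ n _ k "Q * P"])
    fix x :: "'a vec" assume x: "x \<in> carrier_vec n"
    have eq: "(Q * P) *\<^sub>v x = Q *\<^sub>v (P *\<^sub>v x)" and Px: "P *\<^sub>v x \<in> carrier_vec m"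
      using A B x by (auto simp: assoc_mult_mat_vec [of _ k m _ n])
    show "x = 0\<^sub>v n" if "(Q * P) *\<^sub>v x = 0\<^sub>v k"
      using that A(4) B(4) x Px unfolding eq by simp
    show "qf_value C ((Q * P) *\<^sub>v x) = qf_value A x"
      unfolding eq using A(5) B(5) x Px by simp
  qed (use A B in auto)
qed

lemma isometric_square: "A \<simeq> B \<Longrightarrow> dim_col A = dim_row A \<and> dim_col B = dim_row B \<and> dim_row A = dim_row B"
  by (auto simp: isometric_def)

text \<open>
  An injective square matrix over a field has nonzero determinant and is therefore invertible.
\<close>

lemma isometric_iff_embeds: "A \<simeq> B \<longleftrightarrow> A \<lesssim> B \<and> dim_row A = dim_row B"
proof
  assume "A \<simeq> B"
  then obtain n P where A: "A \<in> carrier_mat n n" "B \<in> carrier_mat n n" "P \<in> carrier_mat n n"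
    and inv: "invertible_mat P"
    and val: "\<And>x. x \<in> carrier_vec n \<Longrightarrow> qf_value B (P *\<^sub>v x) = qf_value A x"
    unfolding isometric_def by blast
  from inv obtain Q where Q: "P * Q = 1\<^sub>m (dim_row P)" "Q * P = 1\<^sub>m (dim_row Q)"
    unfolding invertible_mat_def inverts_mat_def by blast
  have dQ: "Q \<in> carrier_mat n n"
    using arg_cong [OF Q(1), of dim_col] arg_cong [OF Q(2), of dim_col] A(3) by auto
  have "x = 0\<^sub>v n" if x: "x \<in> carrier_vec n" and Px: "P *\<^sub>v x = 0\<^sub>v n" for x
  proof -
    have "x = (Q * P) *\<^sub>v x"
      using x dQ by (simp add: Q(2))
    also have "\<dots> = Q *\<^sub>v (P *\<^sub>v x)"
      using assoc_mult_mat_vec [OF dQ A(3) x] .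
    finally show ?thesis
      using Px dQ by (simp)
  qed
  then have "A \<lesssim> B"
    using A val by (intro embedsI [of A n B n P])
  then show "A \<lesssim> B \<and> dim_row A = dim_row B"
    using A by simp
next
  assume *: "A \<lesssim> B \<and> dim_row A = dim_row B"
  then obtain n m P where A: "A \<in> carrier_mat n n" "B \<in> carrier_mat m m" "P \<in> carrier_mat m n"
    and inj: "\<And>x. x \<in> carrier_vec n \<Longrightarrow> P *\<^sub>v x = 0\<^sub>v m \<Longrightarrow> x = 0\<^sub>v n"
    and val: "\<And>x. x \<in> carrier_vec n \<Longrightarrow> qf_value B (P *\<^sub>v x) = qf_value A x"
    by (elim conjE embedsE) blast
  with * have [simp]: "m = n"
    by auto
  have P: "P \<in> carrier_mat n n"
    using A(3) by simp
  have "det P \<noteq> 0"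
    using inj det_0_iff_vec_prod_zero_field [OF P] by auto
  from det_non_zero_imp_unit [OF P this, of "()"] have "invertible_mat P"
    using P unfolding Units_def ring_mat_def invertible_mat_def inverts_mat_def by auto
  then show "A \<simeq> B"
    using A val unfolding isometric_def by auto
qed

lemma isometric_imp_embeds: "A \<simeq> B \<Longrightarrow> A \<lesssim> B"
  by (simp add: isometric_iff_embeds)

lemma embeds_isometric_trans [trans]: "A \<lesssim> B \<Longrightarrow> B \<simeq> C \<Longrightarrow> A \<lesssim> C"
  by (rule embeds_trans [OF _ isometric_imp_embeds])

lemma isometric_refl: "A \<in> carrier_mat n n \<Longrightarrow> A \<simeq> A"
  using embeds_refl isometric_iff_embeds by blast

lemma isometric_trans [trans]: "A \<simeq> B \<Longrightarrow> B \<simeq> C \<Longrightarrow> A \<simeq> C"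
  unfolding isometric_iff_embeds using embeds_trans by auto

lemma isometric_sym:
  assumes "A \<simeq> B"
  shows "B \<simeq> A"
proof -
  obtain n P where A: "A \<in> carrier_mat n n" "B \<in> carrier_mat n n" "P \<in> carrier_mat n n"
    and inv: "invertible_mat P"
    and val: "\<And>x. x \<in> carrier_vec n \<Longrightarrow> qf_value B (P *\<^sub>v x) = qf_value A x"
    using assms unfolding isometric_def by blast
  from inv obtain Q where Q: "P * Q = 1\<^sub>m (dim_row P)" "Q * P = 1\<^sub>m (dim_row Q)"
    unfolding invertible_mat_def inverts_mat_def by blast
  have dQ: "Q \<in> carrier_mat n n"
    using arg_cong [OF Q(1), of dim_col] arg_cong [OF Q(2), of dim_col] A(3) by auto
  then have "invertible_mat Q"
    using Q A unfolding invertible_mat_def inverts_mat_def by auto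
  moreover have "qf_value A (Q *\<^sub>v x) = qf_value B x" if x: "x \<in> carrier_vec n" for x
  proof -
    have "qf_value A (Q *\<^sub>v x) = qf_value B (P *\<^sub>v (Q *\<^sub>v x))"
      using val dQ x by simp
    also have "P *\<^sub>v (Q *\<^sub>v x) = x"
      using x A(3) by (simp add: assoc_mult_mat_vec [OF A(3) dQ x, symmetric] Q(1))
    finally show ?thesis .
  qed
  ultimately show ?thesis
    using A dQ unfolding isometric_def by auto
qed

text \<open>
  All explicit maps between orthogonal sums below are given by four blocks.
\<close>

lemma embeds_blockI:
  assumes A: "A \<in> carrier_mat n n" "B \<in> carrier_mat m m"
    "C \<in> carrier_mat n' n'" "D \<in> carrier_mat m' m'"
    and P: "P11 \<in> carrier_mat n' n" "P12 \<in> carrier_mat n' m"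
     "P21 \<in> carrier_mat m' n" "P22 \<in> carrier_mat m' m"
    and inj: "\<And>x y. x \<in> carrier_vec n \<Longrightarrow> y \<in> carrier_vec m \<Longrightarrow> P11 *\<^sub>v x + P12 *\<^sub>v y = 0\<^sub>v n' \<Longrightarrow>
       P21 *\<^sub>v x + P22 *\<^sub>v y = 0\<^sub>v m' \<Longrightarrow> x = 0\<^sub>v n \<and> y = 0\<^sub>v m"
    and val: "\<And>x y. x \<in> carrier_vec n \<Longrightarrow> y \<in> carrier_vec m \<Longrightarrow>
       qf_value C (P11 *\<^sub>v x + P12 *\<^sub>v y) + qf_value D (P21 *\<^sub>v x + P22 *\<^sub>v y) = qf_value A x + qf_value B y"
  shows "A \<perp> B \<lesssim> C \<perp> D"
proof (rule embedsI)
  let ?P = "four_block_mat P11 P12 P21 P22"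
  fix z :: "'a vec" assume "z \<in> carrier_vec (n + m)"
  then obtain x y where z: "z = x @\<^sub>v y" and x: "x \<in> carrier_vec n" and y: "y \<in> carrier_vec m"
    by (rule vec_append_cases)
  have eq: "?P *\<^sub>v z = (P11 *\<^sub>v x + P12 *\<^sub>v y) @\<^sub>v (P21 *\<^sub>v x + P22 *\<^sub>v y)"
    unfolding z by (rule four_block_mat_mult_vec [OF P x y])
  have c: "P11 *\<^sub>v x + P12 *\<^sub>v y \<in> carrier_vec n'" "P21 *\<^sub>v x + P22 *\<^sub>v y \<in> carrier_vec m'"
    using P x y by auto
  show "z = 0\<^sub>v (n + m)" if "?P *\<^sub>v z = 0\<^sub>v (n' + m')"
    using that inj [OF x y] unfolding eq by (simp add: zero_vec_append c z x)
  show "qf_value (C \<perp> D) (?P *\<^sub>v z) = qf_value (A \<perp> B) z"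
    unfolding eq unfolding z using val [OF x y] c A x y by (simp add: qf_value_orth_sum [of _ n' _ m'] qf_value_orth_sum [of _ n _ m])
qed (use A P in auto)

lemma embeds_orth_sum_mono:
  assumes "A \<lesssim> C" "B \<lesssim> D"
  shows "A \<perp> B \<lesssim> C \<perp> D"
proof -
  obtain n m P where A: "A \<in> carrier_mat n n" "C \<in> carrier_mat m m" "P \<in> carrier_mat m n"
    "\<And>x. x \<in> carrier_vec n \<Longrightarrow> P *\<^sub>v x = 0\<^sub>v m \<Longrightarrow> x = 0\<^sub>v n"
    "\<And>x. x \<in> carrier_vec n \<Longrightarrow> qf_value C (P *\<^sub>v x) = qf_value A x"
    using assms(1) by (rule embedsE) blast
  obtain n' m' Q where B: "B \<in> carrier_mat n' n'" "D \<in> carrier_mat m' m'" "Q \<in> carrier_mat m' n'"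
    "\<And>x. x \<in> carrier_vec n' \<Longrightarrow> Q *\<^sub>v x = 0\<^sub>v m' \<Longrightarrow> x = 0\<^sub>v n'"
    "\<And>x. x \<in> carrier_vec n' \<Longrightarrow> qf_value D (Q *\<^sub>v x) = qf_value B x"
    using assms(2) by (rule embedsE) blast
  show ?thesis
    by (rule embeds_blockI [of A n B n' C m D m' P "0\<^sub>m m n'" "0\<^sub>m m' n" Q]) (use A B in auto)
qed

lemma isometric_orth_sum:
  "A \<simeq> C \<Longrightarrow> B \<simeq> D \<Longrightarrow> A \<perp> B \<simeq> C \<perp> D"
  unfolding isometric_iff_embeds using embeds_orth_sum_mono by auto

lemma isometric_orth_sum_commute:
  assumes A: "A \<in> carrier_mat n n" and B: "B \<in> carrier_mat m m"
  shows "A \<perp> B \<simeq> B \<perp> A"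
  unfolding isometric_iff_embeds
proof
  show "A \<perp> B \<lesssim> B \<perp> A"
    by (rule embeds_blockI [of A n B m B m A n "0\<^sub>m m n" "1\<^sub>m m" "1\<^sub>m n" "0\<^sub>m n m"])
      (use A B in \<open>auto simp: add.commute\<close>)
qed (use A B in auto)

lemma embeds_smult: "A \<lesssim> B \<Longrightarrow> c \<cdot>\<^sub>m A \<lesssim> c \<cdot>\<^sub>m B"
proof (elim embedsE)
  fix n m P
  assume A: "A \<in> carrier_mat n n" "B \<in> carrier_mat m m" "P \<in> carrier_mat m n"
    "\<And>x. x \<in> carrier_vec n \<Longrightarrow> P *\<^sub>v x = 0\<^sub>v m \<Longrightarrow> x = 0\<^sub>v n"
    "\<And>x. x \<in> carrier_vec n \<Longrightarrow> qf_value B (P *\<^sub>v x) = qf_value A x"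
  show ?thesis
    by (rule embedsI [of _ n _ m P]) (use A in \<open>auto simp: qf_value_smult [of _ n] qf_value_smult [of _ m]\<close>)
qed

lemma isometric_smult: "A \<simeq> B \<Longrightarrow> c \<cdot>\<^sub>m A \<simeq> c \<cdot>\<^sub>m B"
  unfolding isometric_iff_embeds using embeds_smult by auto

text \<open>
  In \<open>\<langle>u,v\<rangle>\<close> the vectors \<open>(1,1)\<close> and \<open>(v,-u)\<close> are orthogonal with values \<open>u + v\<close> and \<open>uv(u + v)\<close>. The
  polar terms of \<open>A\<close> cancel for the same reason, in every characteristic.
\<close>

lemma isometric_smult_orth_sum_smult:
  assumes A: "A \<in> carrier_mat n n" and uv: "u + v \<noteq> 0"
  shows "(u + v) \<cdot>\<^sub>m A \<perp> (u * v * (u + v)) \<cdot>\<^sub>m A \<simeq> u \<cdot>\<^sub>m A \<perp> v \<cdot>\<^sub>m A"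
  unfolding isometric_iff_embeds
proof
  show "(u + v) \<cdot>\<^sub>m A \<perp> (u * v * (u + v)) \<cdot>\<^sub>m A \<lesssim> u \<cdot>\<^sub>m A \<perp> v \<cdot>\<^sub>m A"
  proof (rule embeds_blockI [of _ n _ n _ n _ n "1\<^sub>m n" "v \<cdot>\<^sub>m 1\<^sub>m n" "1\<^sub>m n" "(- u) \<cdot>\<^sub>m 1\<^sub>m n"])
    fix x y :: "'a vec" assume xy: "x \<in> carrier_vec n" "y \<in> carrier_vec n"
    have m: "(c \<cdot>\<^sub>m 1\<^sub>m n) *\<^sub>v y = c \<cdot>\<^sub>v y" for c
      using xy by (simp add: smult_mat_mult_vec [of _ n n])
    show "qf_value (u \<cdot>\<^sub>m A) (1\<^sub>m n *\<^sub>v x + v \<cdot>\<^sub>m 1\<^sub>m n *\<^sub>v y) + qf_value (v \<cdot>\<^sub>m A) (1\<^sub>m n *\<^sub>v x + - u \<cdot>\<^sub>m 1\<^sub>m n *\<^sub>v y)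
      = qf_value ((u + v) \<cdot>\<^sub>m A) x + qf_value ((u * v * (u + v)) \<cdot>\<^sub>m A) y"
      unfolding m using A xy
      by (simp add: qf_value_smult [OF A] qf_value_lin [OF A])  (simp add: algebra_simps power2_eq_square)
    assume *: "1\<^sub>m n *\<^sub>v x + v \<cdot>\<^sub>m 1\<^sub>m n *\<^sub>v y = 0\<^sub>v n" "1\<^sub>m n *\<^sub>v x + - u \<cdot>\<^sub>m 1\<^sub>m n *\<^sub>v y = 0\<^sub>v n"
    have y0: "y $ i = 0 \<and> x $ i = 0" if i: "i < n" for i
    proof -
      have "x $ i + v * y $ i = 0" "x $ i - u * y $ i = 0"
        using arg_cong [OF *(1), of "\<lambda>z. vec_index z i"] arg_cong [OF *(2), of "\<lambda>z. vec_index z i"] i xy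
        unfolding m by auto
      then have "(u + v) * y $ i = 0" and "x $ i = u * y $ i"
        by (auto simp: algebra_simps)
      then show ?thesis using uv by auto
    qed
    show "x = 0\<^sub>v n \<and> y = 0\<^sub>v n"
      using y0 xy by (auto intro!: eq_vecI)
  qed (use A in auto)
qed (use A in auto)

section \<open>Multiplication by bilinear Pfister forms\<close>

lemma bil_tensor_append: "bil_tensor (B @ B') C = bil_tensor B C @ bil_tensor B' C"
  by (simp add: bil_tensor_def)

lemma bil_tensor_map_mult: "bil_tensor (map ((*) c) B) C = map ((*) c) (bil_tensor B C)"
  by (induction B) (simp_all add: bil_tensor_def mult.assoc)

lemma bil_pfister_form_Cons:
  "bil_pfister_form (a # as) = bil_pfister_form as @ map ((*) (- a)) (bil_pfister_form as)"
  by (simp add: bil_tensor_def map_idI)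

lemma bil_tensor_bil_pfister_form:
  "bil_tensor (bil_pfister_form as) (bil_pfister_form bs) = bil_pfister_form (as @ bs)"
proof (induction as)
  case Nil
  show ?case by (simp add: bil_tensor_def map_idI)
next
  case (Cons a as)
  then show ?case
    by (simp only: append_Cons bil_pfister_form_Cons bil_tensor_append bil_tensor_map_mult)
qed

lemma bil_tensor_qf_append: "bil_tensor_qf (B @ C) A = bil_tensor_qf B A \<perp> bil_tensor_qf C A"
  by (simp add: bil_tensor_qf_def diag_block_mat_append_orth_sum)

lemma bil_tensor_qf_map_mult: "bil_tensor_qf (map ((*) c) B) A = c \<cdot>\<^sub>m bil_tensor_qf B A"
proof (induction B)
  case Nil
  show ?case by (auto simp: bil_tensor_qf_def)
next
  case (Cons b B)
  then show ?case
    by (simp add: bil_tensor_qf_def diag_block_mat_Cons smult_orth_sum smult_smult_mat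
        del: diag_block_mat.simps)
qed

text \<open>
  In characteristic 2 this is \<open>\<langle>\<langle>a\<rangle>\<rangle> \<otimes> A\<close>. Leaving out the sign keeps the facts below valid over every
  field.
\<close>

definition dbl :: "'a::field \<Rightarrow> 'a mat \<Rightarrow> 'a mat" where
  "dbl a A = A \<perp> a \<cdot>\<^sub>m A"

abbreviation pfs :: "'a::field list \<Rightarrow> 'a mat \<Rightarrow> 'a mat" where
  "pfs as A \<equiv> foldr dbl as A"

lemma dbl_dim [simp]: "dim_row (dbl a A) = 2 * dim_row A" "dim_col (dbl a A) = 2 * dim_col A"
  by (auto simp: dbl_def)

lemma pfs_dim [simp]:
  "dim_row (pfs as A) = 2 ^ length as * dim_row A" "dim_col (pfs as A) = 2 ^ length as * dim_col A"
  by (induction as) auto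

lemma dbl_carrier [simp, intro]: "A \<in> carrier_mat n n \<Longrightarrow> dbl a A \<in> carrier_mat (2 * n) (2 * n)"
  by (intro carrier_matI) auto

lemma pfs_carrier [simp, intro]:
  "A \<in> carrier_mat n n \<Longrightarrow> pfs as A \<in> carrier_mat (2 ^ length as * n) (2 ^ length as * n)"
  by (intro carrier_matI) auto

lemma smult_dbl: "c \<cdot>\<^sub>m dbl a A = dbl a (c \<cdot>\<^sub>m A)"
  by (simp add: dbl_def smult_orth_sum smult_smult_mat mult.commute)

lemma smult_pfs: "c \<cdot>\<^sub>m pfs as A = pfs as (c \<cdot>\<^sub>m A)"
  by (induction as) (simp_all add: smult_dbl)

lemma dbl_cong: "A \<simeq> B \<Longrightarrow> dbl a A \<simeq> dbl a B"
  unfolding dbl_def by (intro isometric_orth_sum isometric_smult)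

lemma pfs_cong: "A \<simeq> B \<Longrightarrow> pfs as A \<simeq> pfs as B"
  by (induction as) (auto intro: dbl_cong)

lemma orth_sum_swap_middle:
  assumes "A \<in> carrier_mat a a" "B \<in> carrier_mat b b" "C \<in> carrier_mat c c" "D \<in> carrier_mat d d"
  shows "(A \<perp> B) \<perp> (C \<perp> D) \<simeq> (A \<perp> C) \<perp> (B \<perp> D)"
proof -
  have "A \<perp> ((B \<perp> C) \<perp> D) \<simeq> A \<perp> ((C \<perp> B) \<perp> D)"
    using assms by (intro isometric_orth_sum isometric_orth_sum_commute isometric_refl)
  then show ?thesis
    by (simp add: orth_sum_assoc)
qed

lemma dbl_orth_sum:
  assumes "A \<in> carrier_mat n n" "B \<in> carrier_mat m m"
  shows "dbl a (A \<perp> B) \<simeq> dbl a A \<perp> dbl a B"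
  unfolding dbl_def smult_orth_sum using assms by (intro orth_sum_swap_middle) auto

lemma dbl_commute:
  assumes "A \<in> carrier_mat n n"
  shows "dbl a (dbl b A) \<simeq> dbl b (dbl a A)"
proof -
  have "dbl a (A \<perp> b \<cdot>\<^sub>m A) \<simeq> dbl a A \<perp> dbl a (b \<cdot>\<^sub>m A)"
    using assms by (intro dbl_orth_sum) auto
  then show ?thesis
    by (simp add: dbl_def [of b] smult_dbl)
qed

lemma pfs_dbl_commute:
  assumes "A \<in> carrier_mat n n"
  shows "pfs as (dbl b A) \<simeq> dbl b (pfs as A)"
proof (induction as)
  case Nil
  then show ?case using assms by (auto intro: isometric_refl)
next
  case (Cons a as)
  have "dbl a (pfs as (dbl b A)) \<simeq> dbl a (dbl b (pfs as A))"
    using Cons by (rule dbl_cong)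
  also have "\<dots> \<simeq> dbl b (dbl a (pfs as A))"
    using assms by (intro dbl_commute) auto
  finally show ?case by simp
qed

lemma pfs_commute:
  assumes "A \<in> carrier_mat n n"
  shows "pfs as (pfs bs A) \<simeq> pfs bs (pfs as A)"
proof (induction as)
  case Nil
  then show ?case using assms by (auto intro: isometric_refl)
next
  case (Cons a as)
  have "dbl a (pfs as (pfs bs A)) \<simeq> dbl a (pfs bs (pfs as A))"
    using Cons by (rule dbl_cong)
  also have "\<dots> \<simeq> pfs bs (dbl a (pfs as A))"
    using assms by (intro isometric_sym [OF pfs_dbl_commute]) auto
  finally show ?case by simp
qed

text \<open>
  A slot may be multiplied by any similarity factor of the form to which it is applied.
\<close>

lemma dbl_mult_similarity:
  assumes "u \<cdot>\<^sub>m A \<simeq> A"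
  shows "dbl (u * a) A \<simeq> dbl a A"
proof -
  have A: "A \<in> carrier_mat (dim_row A) (dim_row A)"
    using isometric_square [OF assms] by auto
  have "a \<cdot>\<^sub>m (u \<cdot>\<^sub>m A) \<simeq> a \<cdot>\<^sub>m A"
    using assms by (rule isometric_smult)
  then show ?thesis
    unfolding dbl_def using isometric_refl [OF A]
    by (intro isometric_orth_sum) (auto simp: smult_smult_mat mult.commute)
qed

text \<open>
  The two middle terms of \<open>A \<perp> bA \<perp> aA \<perp> abA\<close> are rewritten by \<open>isometric_smult_orth_sum_smult\<close>.
\<close>

lemma dbl_dbl_add:
  assumes A: "A \<in> carrier_mat n n" and ab: "a + b \<noteq> 0"
  shows "dbl a (dbl b A) \<simeq> dbl (a + b) (dbl (a * b) A)"
proof -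
  have "dbl a (dbl b A) = A \<perp> ((b \<cdot>\<^sub>m A \<perp> a \<cdot>\<^sub>m A) \<perp> (a * b) \<cdot>\<^sub>m A)"
    by (simp add: dbl_def smult_orth_sum smult_smult_mat orth_sum_assoc)
  also have "\<dots> \<simeq> A \<perp> (((b + a) \<cdot>\<^sub>m A \<perp> (b * a * (b + a)) \<cdot>\<^sub>m A) \<perp> (a * b) \<cdot>\<^sub>m A)"
    using A ab by (intro isometric_orth_sum isometric_sym [OF isometric_smult_orth_sum_smult] isometric_refl)
      (auto simp: add.commute)
  also have "\<dots> = (A \<perp> (a + b) \<cdot>\<^sub>m A) \<perp> ((a * b) * (a + b)) \<cdot>\<^sub>m A \<perp> (a * b) \<cdot>\<^sub>m A"
    by (simp add: orth_sum_assoc ac_simps)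
  also have "\<dots> \<simeq> (A \<perp> (a + b) \<cdot>\<^sub>m A) \<perp> (a * b) \<cdot>\<^sub>m A \<perp> ((a * b) * (a + b)) \<cdot>\<^sub>m A"
    using A by (intro isometric_orth_sum isometric_refl isometric_orth_sum_commute) auto
  also have "\<dots> \<simeq> (A \<perp> (a * b) \<cdot>\<^sub>m A) \<perp> (a + b) \<cdot>\<^sub>m A \<perp> ((a * b) * (a + b)) \<cdot>\<^sub>m A"
    using A by (intro orth_sum_swap_middle) auto
  also have "\<dots> = dbl (a + b) (dbl (a * b) A)"
    by (simp add: dbl_def smult_orth_sum smult_smult_mat ac_simps)
  finally show ?thesis .
qed

section \<open>Represented values and round forms\<close>

definition isotropic :: "'a::field mat \<Rightarrow> bool" where
  "isotropic A \<longleftrightarrow> (\<exists>x \<in> carrier_vec (dim_row A). x \<noteq> 0\<^sub>v (dim_row A) \<and> qf_value A x = 0)"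

definition represents :: "'a::field mat \<Rightarrow> 'a \<Rightarrow> bool" where
  "represents A c \<longleftrightarrow> (\<exists>x \<in> carrier_vec (dim_row A). qf_value A x = c)"

lemma embeds_isotropic: "A \<lesssim> B \<Longrightarrow> isotropic A \<Longrightarrow> isotropic B"
  unfolding embeds_def isotropic_def by (metis carrier_matD(1) mult_mat_vec_carrier)

lemma embeds_represents: "A \<lesssim> B \<Longrightarrow> represents A c \<Longrightarrow> represents B c"
  unfolding embeds_def represents_def by (metis carrier_matD(1) mult_mat_vec_carrier)

lemma represents_smultI:
  assumes "represents A t" "A \<in> carrier_mat n n"
  shows "represents (c \<cdot>\<^sub>m A) (c * t)"
  using assms by (auto simp: represents_def qf_value_smult)

lemma represents_mult_square:
  assumes A: "A \<in> carrier_mat n n" and t: "represents A t"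
  shows "represents A (c\<^sup>2 * t)"
proof -
  obtain x where x: "x \<in> carrier_vec n" "qf_value A x = t"
    using assms by (auto simp: represents_def)
  then have "qf_value A (c \<cdot>\<^sub>v x) = c\<^sup>2 * t"
    using A by (simp add: qf_value_smult_vec)
  then show ?thesis
    using x(1) A unfolding represents_def by (intro bexI [of _ "c \<cdot>\<^sub>v x"]) auto
qed

lemma represents_orth_sumE:
  assumes "represents (A \<perp> B) c" "A \<in> carrier_mat n n" "B \<in> carrier_mat m m"
  obtains u v where "c = u + v" "represents A u" "represents B v"
proof -
  from assms(1) obtain z where "z \<in> carrier_vec (dim_row A + dim_row B)" "qf_value (A \<perp> B) z = c"
    unfolding represents_def by auto
  moreover from this obtain x y where "z = x @\<^sub>v y" "x \<in> carrier_vec (dim_row A)" "y \<in> carrier_vec (dim_row B)"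
    by (elim vec_append_cases)
  ultimately show ?thesis
    using that [of "qf_value A x" "qf_value B y"] assms(2,3)
    by (auto simp: represents_def qf_value_orth_sum [of _ n _ m])
qed

lemma represents_smultD:
  assumes "represents (c \<cdot>\<^sub>m A) t" "A \<in> carrier_mat n n"
  shows "\<exists>s. t = c * s \<and> represents A s"
  using assms by (auto simp: represents_def qf_value_smult)

lemma represents_dblE:
  assumes "represents (dbl a A) c" "A \<in> carrier_mat n n"
  obtains u v where "c = u + a * v" "represents A u" "represents A v"
proof -
  obtain u w where "c = u + w" "represents A u" "represents (a \<cdot>\<^sub>m A) w"
    using assms unfolding dbl_def by (elim represents_orth_sumE) auto
  then show ?thesis
    using represents_smultD [OF _ assms(2)] that by blast
qed

text \<open>
  An isotropic vector \<open>(x, y)\<close> has both components nonzero, since a vanishing component would leave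
  an isotropic vector of \<open>A\<close>.
\<close>

lemma isotropic_dblE:
  assumes "isotropic (dbl a A)" "A \<in> carrier_mat n n" "\<not> isotropic A" "a \<noteq> 0"
  obtains u v where "u + a * v = 0" "u \<noteq> 0" "v \<noteq> 0" "represents A u" "represents A v"
proof -
  from assms(1,2) obtain z where z: "z \<in> carrier_vec (n + n)" "z \<noteq> 0\<^sub>v (n + n)" "qf_value (dbl a A) z = 0"
    unfolding isotropic_def by (auto simp: mult_2)
  from z(1) obtain x y where xy: "z = x @\<^sub>v y" "x \<in> carrier_vec n" "y \<in> carrier_vec n"
    by (elim vec_append_cases)
  have eq: "qf_value A x + a * qf_value A y = 0"
    using z(3) assms(2) xy by (simp add: dbl_def qf_value_orth_sum [of _ n _ n] qf_value_smult)
  have nz: "w = 0\<^sub>v n" if "w \<in> carrier_vec n" "qf_value A w = 0" for w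
    using assms(2,3) that by (auto simp: isotropic_def)
  have "x \<noteq> 0\<^sub>v n \<or> y \<noteq> 0\<^sub>v n"
    using z(2) xy by (simp add: zero_vec_append)
  then have y: "qf_value A y \<noteq> 0 \<or> qf_value A x \<noteq> 0"
    using nz xy by blast
  with eq assms(4) have "qf_value A x \<noteq> 0 \<and> qf_value A y \<noteq> 0" by auto
  then show ?thesis
    using that [of "qf_value A x" "qf_value A y"] eq xy assms(2) by (auto simp: represents_def)
qed

definition round_form :: "'a::field mat \<Rightarrow> bool" where
  "round_form A \<longleftrightarrow> (\<forall>c. c \<noteq> 0 \<longrightarrow> represents A c \<longrightarrow> c \<cdot>\<^sub>m A \<simeq> A)"

lemma isometric_smult_square:
  assumes A: "A \<in> carrier_mat n n" and c: "c \<noteq> 0"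
  shows "c\<^sup>2 \<cdot>\<^sub>m A \<simeq> A"
  unfolding isometric_iff_embeds
proof
  show "c\<^sup>2 \<cdot>\<^sub>m A \<lesssim> A"
  proof (rule embedsI [of _ n _ n "c \<cdot>\<^sub>m 1\<^sub>m n"])
    fix x :: "'a vec" assume x: "x \<in> carrier_vec n"
    have eq: "c \<cdot>\<^sub>m 1\<^sub>m n *\<^sub>v x = c \<cdot>\<^sub>v x"
      using x by (simp add: smult_mat_mult_vec [of _ n n])
    show "qf_value A (c \<cdot>\<^sub>m 1\<^sub>m n *\<^sub>v x) = qf_value (c\<^sup>2 \<cdot>\<^sub>m A) x"
      unfolding eq using A x by (simp add: qf_value_smult qf_value_smult_vec)
    assume "c \<cdot>\<^sub>m 1\<^sub>m n *\<^sub>v x = 0\<^sub>v n"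
    then have "inverse c \<cdot>\<^sub>v (c \<cdot>\<^sub>v x) = 0\<^sub>v n"
      unfolding eq by auto
    then show "x = 0\<^sub>v n"
      using c by (simp add: smult_smult_assoc)
  qed (use A in auto)
qed (use A in auto)

text \<open>
  For a value \<open>c = u + av\<close> with \<open>u\<close> and \<open>v\<close> nonzero, roundness of \<open>A\<close> gives
  \<open>A \<perp> aA = uA \<perp> avA = cA \<perp> (uavc)A = cA \<perp> acA\<close>. If \<open>u\<close> or \<open>v\<close> vanishes, \<open>c\<close> or \<open>ac\<close> is a similarity factor of
  \<open>A\<close> up to a square.
\<close>

lemma round_dbl:
  assumes A: "A \<in> carrier_mat n n" and r: "round_form A" and a: "a \<noteq> 0"
  shows "round_form (dbl a A)"
  unfolding round_form_def
proof safe
  fix c assume c: "c \<noteq> 0" and "represents (dbl a A) c"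
  then obtain u v where uv: "c = u + a * v" "represents A u" "represents A v"
    using A by (elim represents_dblE)
  have u: "u \<cdot>\<^sub>m A \<simeq> A" if "u \<noteq> 0"
    using r uv that by (auto simp: round_form_def)
  have v: "v \<cdot>\<^sub>m A \<simeq> A" if "v \<noteq> 0"
    using r uv that by (auto simp: round_form_def)
  consider "v = 0" "u \<noteq> 0" | "u = 0" "v \<noteq> 0" | "u \<noteq> 0" "v \<noteq> 0"
    using c uv by (cases "u = 0"; cases "v = 0"; simp)
  then show "c \<cdot>\<^sub>m dbl a A \<simeq> dbl a A"
  proof cases
    case 1
    then show ?thesis
      unfolding smult_dbl using u uv(1) by (intro dbl_cong) auto
  next
    case 2
    have "c \<cdot>\<^sub>m dbl a A = a \<cdot>\<^sub>m (v \<cdot>\<^sub>m A) \<perp> a\<^sup>2 \<cdot>\<^sub>m (v \<cdot>\<^sub>m A)"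
      using 2 uv(1) by (simp add: dbl_def smult_orth_sum smult_smult_mat power2_eq_square ac_simps)
    also have "\<dots> \<simeq> a \<cdot>\<^sub>m A \<perp> A"
      using 2 v a A by (intro isometric_orth_sum isometric_smult isometric_trans [OF isometric_smult_square v]) auto
    also have "\<dots> \<simeq> dbl a A"
      unfolding dbl_def using A by (intro isometric_orth_sum_commute) auto
    finally show ?thesis .
  next
    case 3
    have "c \<cdot>\<^sub>m dbl a A = c \<cdot>\<^sub>m A \<perp> (a * c) \<cdot>\<^sub>m A"
      by (simp add: dbl_def smult_orth_sum smult_smult_mat ac_simps)
    also have "\<dots> \<simeq> c \<cdot>\<^sub>m A \<perp> (a * c) \<cdot>\<^sub>m (u \<cdot>\<^sub>m (v \<cdot>\<^sub>m A))"
      using A 3 by (intro isometric_orth_sum isometric_refl isometric_smult isometric_sym [OF isometric_trans [OF isometric_smult [OF v] u]]) auto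
    also have "\<dots> = (u + a * v) \<cdot>\<^sub>m A \<perp> (u * (a * v) * (u + a * v)) \<cdot>\<^sub>m A"
      by (simp add: smult_smult_mat uv(1) ac_simps)
    also have "\<dots> \<simeq> u \<cdot>\<^sub>m A \<perp> (a * v) \<cdot>\<^sub>m A"
      using A c uv(1) by (intro isometric_smult_orth_sum_smult) auto
    also have "\<dots> = u \<cdot>\<^sub>m A \<perp> a \<cdot>\<^sub>m (v \<cdot>\<^sub>m A)"
      by (simp add: smult_smult_mat)
    also have "\<dots> \<simeq> dbl a A"
      unfolding dbl_def using 3 u v by (intro isometric_orth_sum isometric_smult) auto
    finally show ?thesis .
  qed
qed

definition vec2 :: "'a \<Rightarrow> 'a \<Rightarrow> 'a vec" where
  "vec2 x y = vec 2 (\<lambda>i. if i = 0 then x else y)"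

definition mat2 :: "'a \<Rightarrow> 'a \<Rightarrow> 'a \<Rightarrow> 'a \<Rightarrow> 'a mat" where
  "mat2 a b c d = mat 2 2 (\<lambda>(i, j). if i = 0 then if j = 0 then a else b else if j = 0 then c else d)"

lemma vec2_cases:
  assumes "x \<in> carrier_vec 2"
  obtains a b where "x = vec2 a b"
proof
  show "x = vec2 (x $ 0) (x $ 1)"
    using assms by (intro eq_vecI) (auto simp: vec2_def less_2_cases_iff)
qed

lemma vec2_carrier [simp]: "vec2 x y \<in> carrier_vec 2"
  by (simp add: vec2_def)

lemma mat2_carrier [simp]: "mat2 a b c d \<in> carrier_mat 2 2"
  by (simp add: mat2_def)

lemma mat2_mult_vec2 [simp]:
  "mat2 a b c d *\<^sub>v vec2 x y = vec2 (a * x + b * y) (c * x + d * y)"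
  by (intro eq_vecI) (auto simp: mat2_def vec2_def less_2_cases_iff scalar_prod_def numeral_2_eq_2)

lemma vec2_simps [simp]:
  "vec2 x y + vec2 x' y' = vec2 (x + x') (y + y')"
  "vec2 x y = 0\<^sub>v 2 \<longleftrightarrow> x = 0 \<and> y = 0"
  by (auto simp: vec2_def vec_eq_iff numeral_2_eq_2 less_Suc_eq)

lemma binary_qf_eq_mat2: "binary_qf a b = mat2 a 1 0 b"
  by (rule eq_matI) (auto simp: binary_qf_def mat_of_rows_list_def mat2_def less_2_cases_iff)

lemma binary_qf_carrier [simp]: "binary_qf a b \<in> carrier_mat 2 2"
  by (simp add: binary_qf_eq_mat2)

lemma binary_qf_dim [simp]: "dim_row (binary_qf a b) = 2" "dim_col (binary_qf a b) = 2"
  using binary_qf_carrier by blast+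

lemma scalar_prod_vec2 [simp]: "vec2 x y \<bullet> vec2 z w = x * z + y * w"
  by (simp add: scalar_prod_def vec2_def numeral_2_eq_2)

lemma qf_value_binary [simp]: "qf_value (binary_qf a b) (vec2 x y) = a * x\<^sup>2 + x * y + b * y\<^sup>2"
  by (simp add: qf_value_def binary_qf_eq_mat2 algebra_simps power2_eq_square)

text \<open>
  The form \<open>[1,d]\<close> is the norm form of the algebra generated by \<open>\<theta>\<close> with \<open>\<theta>\<^sup>2 = \<theta> - d\<close>. The matrix is
  that of multiplication by \<open>p + q\<theta>\<close>, which multiplies norms by \<open>p\<^sup>2 + pq + dq\<^sup>2\<close>.
\<close>

lemma round_binary: "round_form (binary_qf 1 d)"
  unfolding round_form_def
proof safe
  fix c :: 'a assume c: "c \<noteq> 0" and "represents (binary_qf 1 d) c"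
  then obtain v where "v \<in> carrier_vec 2" and v: "qf_value (binary_qf 1 d) v = c"
    by (auto simp: represents_def)
  then obtain p q where "v = vec2 p q"
    by (elim vec2_cases)
  with v have pq: "p\<^sup>2 + p * q + d * q\<^sup>2 = c"
    by simp
  have "c \<cdot>\<^sub>m binary_qf 1 d \<lesssim> binary_qf 1 d"
  proof (rule embedsI [of _ 2 _ 2 "mat2 p (- d * q) q (p + q)"])
    fix z :: "'a vec" assume z: "z \<in> carrier_vec 2"
    then obtain x y where xy: "z = vec2 x y"
      by (rule vec2_cases)
    show "qf_value (binary_qf 1 d) (mat2 p (- d * q) q (p + q) *\<^sub>v z) = qf_value (c \<cdot>\<^sub>m binary_qf 1 d) z"
      unfolding xy qf_value_smult [OF binary_qf_carrier z [unfolded xy]] pq [symmetric] by (simp add: algebra_simps power2_eq_square)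
    show "z = 0\<^sub>v 2" if "mat2 p (- d * q) q (p + q) *\<^sub>v z = 0\<^sub>v 2"
    proof -
      have "p * x - d * q * y = 0" "q * x + (p + q) * y = 0"
        using that by (auto simp: xy)
      moreover have "c * x = (p + q) * (p * x - d * q * y) + d * q * (q * x + (p + q) * y)"
        "c * y = p * (q * x + (p + q) * y) - q * (p * x - d * q * y)"
        unfolding pq [symmetric] by (simp_all add: algebra_simps power2_eq_square)
      ultimately have "c * x = 0" "c * y = 0"
        by simp_all
      then show ?thesis using c xy by simp
    qed
  qed auto
  then show "c \<cdot>\<^sub>m binary_qf 1 d \<simeq> binary_qf 1 d"
    by (simp add: isometric_iff_embeds)
qed

lemma round_pfs:
  assumes "0 \<notin> set as"
  shows "round_form (pfs as (binary_qf 1 d))"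
  using assms
proof (induction as)
  case (Cons a as)
  then show ?case
    by (auto intro!: round_dbl [OF pfs_carrier [OF binary_qf_carrier]])
qed (simp add: round_binary)

section \<open>Hyperbolic forms\<close>

abbreviation hyp_sum :: "nat \<Rightarrow> 'a::field mat" where
  "hyp_sum r \<equiv> diag_block_mat (replicate r (binary_qf 0 0))"

lemma hyp_sum_dim [simp]: "dim_row (hyp_sum r) = 2 * r" "dim_col (hyp_sum r) = 2 * r"
  by (simp_all add: dim_diag_block_mat sum_list_replicate)

lemma hyp_sum_carrier [simp]: "hyp_sum r \<in> carrier_mat (2 * r) (2 * r)"
  by (intro carrier_matI) auto

lemma hyp_sum_Suc: "hyp_sum (Suc r) = binary_qf 0 0 \<perp> hyp_sum r"
  by (simp only: replicate_Suc diag_block_mat_Cons)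

lemma hyp_sum_add: "hyp_sum (r + s) = hyp_sum r \<perp> hyp_sum s"
  by (simp only: replicate_add diag_block_mat_append_orth_sum)

lemma hyperbolic_cong: "A \<simeq> B \<Longrightarrow> hyperbolic A \<longleftrightarrow> hyperbolic B"
  unfolding hyperbolic_def using isometric_trans isometric_sym by blast

lemma hyperbolic_hyp_sum: "hyperbolic (hyp_sum r)"
  unfolding hyperbolic_def using isometric_refl [OF hyp_sum_carrier] by blast

lemma hyperbolic_plane: "hyperbolic (binary_qf 0 0)"
  using hyperbolic_hyp_sum [of 1] by (simp del: diag_block_mat.simps)

lemma hyperbolic_imp_isometric:
  assumes "hyperbolic A" "dim_row A = 2 * r"
  shows "A \<simeq> hyp_sum r"
proof -
  obtain s where s: "A \<simeq> hyp_sum s"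
    using assms(1) unfolding hyperbolic_def by blast
  then have "s = r"
    using isometric_square [OF s] assms(2) by simp
  then show ?thesis
    using s by simp
qed

lemma hyperbolic_even: "hyperbolic A \<Longrightarrow> even (dim_row A)"
  unfolding hyperbolic_def using isometric_square by fastforce

lemma hyperbolic_isometric:
  assumes "hyperbolic A" "hyperbolic B" "dim_row A = dim_row B"
  shows "A \<simeq> B"
proof -
  obtain r where "dim_row A = 2 * r"
    using hyperbolic_even [OF assms(1)] by (auto elim: evenE)
  then show ?thesis
    using assms by (metis hyperbolic_imp_isometric isometric_sym isometric_trans)
qed

lemma hyperbolic_orth_sum:
  assumes "hyperbolic A" "hyperbolic B"
  shows "hyperbolic (A \<perp> B)"
proof -
  from assms obtain r s where "A \<simeq> hyp_sum r" "B \<simeq> hyp_sum s"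
    unfolding hyperbolic_def by blast
  then have "A \<perp> B \<simeq> hyp_sum (r + s)"
    unfolding hyp_sum_add by (rule isometric_orth_sum)
  then show ?thesis
    unfolding hyperbolic_def by blast
qed

lemma hyperbolic_smult:
  assumes A: "hyperbolic A" and c: "c \<noteq> 0"
  shows "hyperbolic (c \<cdot>\<^sub>m A)"
proof -
  have plane: "c \<cdot>\<^sub>m binary_qf 0 0 \<simeq> binary_qf 0 0"
    unfolding isometric_iff_embeds
  proof
    show "c \<cdot>\<^sub>m binary_qf 0 0 \<lesssim> binary_qf 0 0"
    proof (rule embedsI [of _ 2 _ 2 "mat2 c 0 0 1"])
      fix z :: "'a vec" assume z: "z \<in> carrier_vec 2"
      then obtain x y where xy: "z = vec2 x y"
        by (rule vec2_cases)
      show "qf_value (binary_qf 0 0) (mat2 c 0 0 1 *\<^sub>v z) = qf_value (c \<cdot>\<^sub>m binary_qf 0 0) z"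
        by (simp add: xy qf_value_smult [OF binary_qf_carrier])
      show "z = 0\<^sub>v 2" if "mat2 c 0 0 1 *\<^sub>v z = 0\<^sub>v 2"
        using that c by (simp add: xy)
    qed auto
  qed simp
  have "hyperbolic (c \<cdot>\<^sub>m hyp_sum r)" for r
  proof (induction r)
    case 0
    have "c \<cdot>\<^sub>m hyp_sum 0 = hyp_sum 0"
      by auto
    then show ?case
      by (metis hyperbolic_hyp_sum)
  next
    case (Suc r)
    have "hyperbolic (c \<cdot>\<^sub>m binary_qf 0 0)"
      using hyperbolic_cong [OF plane] hyperbolic_plane by blast
    then show ?case
      unfolding hyp_sum_Suc smult_orth_sum using Suc by (rule hyperbolic_orth_sum)
  qed
  moreover obtain r where "A \<simeq> hyp_sum r"
    using A unfolding hyperbolic_def by blast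
  ultimately show ?thesis
    using hyperbolic_cong [OF isometric_smult] by blast
qed

lemma hyperbolic_pfs:
  assumes "hyperbolic A" "0 \<notin> set as"
  shows "hyperbolic (pfs as A)"
  using assms(2)
  by (induction as) (auto simp: assms(1) dbl_def intro!: hyperbolic_orth_sum hyperbolic_smult)

lemma embeds_empty: "A \<in> carrier_mat n n \<Longrightarrow> 0\<^sub>m 0 0 \<lesssim> A"
  by (rule embedsI [of _ 0 _ n "0\<^sub>m n 0"]) (auto simp: qf_value_def scalar_prod_def)

lemma embeds_orth_sum_left:
  assumes "A \<in> carrier_mat n n" "B \<in> carrier_mat m m"
  shows "A \<lesssim> A \<perp> B"
  using embeds_orth_sum_mono [OF embeds_refl [OF assms(1)] embeds_empty [OF assms(2)]] by simp

lemma embeds_dbl: "A \<lesssim> B \<Longrightarrow> dbl a A \<lesssim> dbl a B"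
  unfolding dbl_def by (intro embeds_orth_sum_mono embeds_smult)

lemma embeds_pfs: "A \<lesssim> B \<Longrightarrow> pfs as A \<lesssim> pfs as B"
  by (induction as) (auto intro: embeds_dbl)

lemma embeds_dbl_self: "A \<in> carrier_mat n n \<Longrightarrow> A \<lesssim> dbl a A"
  unfolding dbl_def by (intro embeds_orth_sum_left) auto

lemma embeds_pfs_self: "A \<in> carrier_mat n n \<Longrightarrow> A \<lesssim> pfs as A"
proof (induction as)
  case (Cons a as)
  have "pfs as A \<lesssim> dbl a (pfs as A)"
    using Cons.prems by (intro embeds_dbl_self) auto
  then show ?case
    using Cons embeds_trans by auto
qed (auto intro: embeds_refl)

lemma hyperbolic_plane_embeds:
  assumes "hyperbolic A" "dim_row A > 0"
  shows "binary_qf 0 0 \<lesssim> A"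
proof -
  obtain r where r: "A \<simeq> hyp_sum r"
    using assms(1) unfolding hyperbolic_def by blast
  with assms(2) have "r \<noteq> 0"
    using isometric_square [OF r] by (cases r) simp_all
  then obtain s where s: "r = Suc s"
    using not0_implies_Suc by blast
  have "binary_qf 0 0 \<lesssim> hyp_sum r"
    unfolding s hyp_sum_Suc by (rule embeds_orth_sum_left [OF binary_qf_carrier hyp_sum_carrier])
  also have "\<dots> \<lesssim> A"
    using isometric_sym [OF r] by (rule isometric_imp_embeds)
  finally show ?thesis .
qed

lemma hyperbolic_represents:
  assumes "hyperbolic A" "dim_row A > 0"
  shows "represents A c"
proof (rule embeds_represents [OF hyperbolic_plane_embeds [OF assms]])
  have "qf_value (binary_qf 0 0) (vec2 1 c) = c"
    by simp
  then show "represents (binary_qf 0 0) c"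
    unfolding represents_def by (intro bexI [of _ "vec2 1 c"]) auto
qed

lemma hyperbolic_isotropic:
  assumes "hyperbolic A" "dim_row A > 0"
  shows "isotropic A"
proof (rule embeds_isotropic [OF hyperbolic_plane_embeds [OF assms]])
  show "isotropic (binary_qf 0 0 :: 'a mat)"
    unfolding isotropic_def by (intro bexI [of _ "vec2 1 0"]) auto
qed

section \<open>Pfister forms in characteristic two\<close>

locale char_two =
  fixes ty :: "'a::field itself"
  assumes CHAR_eq_2: "CHAR('a) = 2"
begin

lemma add_self [simp]: "x + x = (0 :: 'a)" "x + (x + y) = (y :: 'a)"
proof -
  have "(1 + 1 :: 'a) = of_nat 2"
    by simp
  also have "\<dots> = 0"
    unfolding of_nat_eq_0_iff_char_dvd CHAR_eq_2 by simp
  finally have "x * (1 + 1) = 0"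
    by simp
  then show *: "x + x = 0"
    by (simp only: distrib_left mult_1_right)
  show "x + (x + y) = y"
    unfolding add.assoc [symmetric] * by simp
qed

lemma uminus_eq: "- x = (x :: 'a)"
  using add_self(1) [of x] by (simp add: minus_unique)

lemma bil_tensor_qf_bil_pfister_form: "bil_tensor_qf (bil_pfister_form as) (A :: 'a mat) = pfs as A"
proof (induction as)
  case Nil
  show ?case by (simp add: bil_tensor_qf_def del: diag_block_mat.simps)
next
  case (Cons a as)
  then show ?case
    by (simp only: bil_pfister_form_Cons bil_tensor_qf_append bil_tensor_qf_map_mult uminus_eq
        foldr_Cons o_apply dbl_def)
qed

text \<open>
  The four columns of the block matrix, \<open>(1,0,1,0)\<close>, \<open>(d,1,d,0)\<close>, \<open>(0,1,0,1)\<close> and \<open>(0,1,1,1)\<close>, are two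
  orthogonal hyperbolic pairs. The first vector of each pair lies on the diagonal of \<open>A \<perp> A\<close>, which is
  totally isotropic in characteristic 2; the second is obtained from \<open>(0,1,0,0)\<close> and \<open>(0,0,1,0)\<close>,
  respectively, by adding the multiple of the first that makes the value zero.
\<close>

lemma hyperbolic_dbl_one_binary: "hyperbolic (dbl 1 (binary_qf 1 (d :: 'a)))"
proof -
  have "binary_qf 0 0 \<perp> binary_qf 0 0 \<lesssim> binary_qf 1 d \<perp> binary_qf 1 d"
  proof (rule embeds_blockI [of _ 2 _ 2 _ 2 _ 2 "mat2 1 d 0 1" "mat2 0 0 1 1" "mat2 1 d 0 0" "mat2 0 1 1 1"])
    fix x y :: "'a vec" assume "x \<in> carrier_vec 2" "y \<in> carrier_vec 2"
    then obtain a b e f where xy: "x = vec2 a b" "y = vec2 e f"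
      by (metis vec2_cases)
    show "x = 0\<^sub>v 2 \<and> y = 0\<^sub>v 2" if "mat2 1 d 0 1 *\<^sub>v x + mat2 0 0 1 1 *\<^sub>v y = 0\<^sub>v 2"
      "mat2 1 d 0 0 *\<^sub>v x + mat2 0 1 1 1 *\<^sub>v y = 0\<^sub>v 2"
      using that by (auto simp: xy add_eq_0_iff uminus_eq)
    show "qf_value (binary_qf 1 d) (mat2 1 d 0 1 *\<^sub>v x + mat2 0 0 1 1 *\<^sub>v y) +
       qf_value (binary_qf 1 d) (mat2 1 d 0 0 *\<^sub>v x + mat2 0 1 1 1 *\<^sub>v y) =
       qf_value (binary_qf 0 0) x + qf_value (binary_qf 0 0) y"
      by (simp add: xy) (simp add: algebra_simps power2_eq_square)
  qed auto
  then have "dbl 1 (binary_qf 1 d) \<simeq> binary_qf 0 0 \<perp> binary_qf 0 0"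
    by - (rule isometric_sym, simp add: isometric_iff_embeds dbl_def)
  moreover have "hyperbolic (binary_qf 0 0 \<perp> binary_qf 0 0 :: 'a mat)"
    by (intro hyperbolic_orth_sum hyperbolic_plane)
  ultimately show ?thesis
    using hyperbolic_cong by blast
qed

lemma hyperbolic_dbl_one_pfs:
  assumes "0 \<notin> set as"
  shows "hyperbolic (dbl 1 (pfs as (binary_qf 1 (d :: 'a))))"
  using hyperbolic_pfs [OF hyperbolic_dbl_one_binary assms, of d] hyperbolic_cong [OF pfs_dbl_commute]
  by (metis binary_qf_carrier)

text \<open>
  Both \<open>1\<close> and \<open>1 + z\<close> are values of \<open>\<langle>1,z\<rangle>\<close>, taken on \<open>e = (1,0,0,0)\<close> and \<open>f = (1,0,1,0)\<close>, which are
  orthogonal for the polar form. The columns of the block matrix are \<open>e\<close>, \<open>(0,1,0,1/z)\<close>, \<open>f\<close> and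
  \<open>(0,0,0,(1+z)/z)\<close>; the second and fourth are the vectors that pair with \<open>e\<close> to \<open>1\<close> and with \<open>f\<close> to
  \<open>1 + z\<close> and are orthogonal to the rest, and the value \<open>d + d/z\<close> of the second gives the new constant.
\<close>

lemma dbl_binary_shift:
  assumes z: "z \<noteq> 0" "1 + z \<noteq> (0 :: 'a)"
  shows "dbl z (binary_qf 1 d) \<simeq> dbl (1 + z) (binary_qf 1 (d + d / z))"
proof -
  have "dbl (1 + z) (binary_qf 1 (d + d / z)) \<lesssim> dbl z (binary_qf 1 d)"
    unfolding dbl_def
  proof (rule embeds_blockI [of _ 2 _ 2 _ 2 _ 2 "mat2 1 0 0 1" "mat2 1 0 0 0" "mat2 0 0 0 (1 / z)" "mat2 1 0 0 ((1 + z) / z)"])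
    fix x y :: "'a vec" assume "x \<in> carrier_vec 2" "y \<in> carrier_vec 2"
    then obtain a b e f where xy: "x = vec2 a b" "y = vec2 e f"
      by (metis vec2_cases)
    show "x = 0\<^sub>v 2 \<and> y = 0\<^sub>v 2" if "mat2 1 0 0 1 *\<^sub>v x + mat2 1 0 0 0 *\<^sub>v y = 0\<^sub>v 2"
      "mat2 0 0 0 (1 / z) *\<^sub>v x + mat2 1 0 0 ((1 + z) / z) *\<^sub>v y = 0\<^sub>v 2"
      using that z by (auto simp: xy)
    show "qf_value (binary_qf 1 d) (mat2 1 0 0 1 *\<^sub>v x + mat2 1 0 0 0 *\<^sub>v y) +
       qf_value (z \<cdot>\<^sub>m binary_qf 1 d) (mat2 0 0 0 (1 / z) *\<^sub>v x + mat2 1 0 0 ((1 + z) / z) *\<^sub>v y) =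
       qf_value (binary_qf 1 (d + d / z)) x + qf_value ((1 + z) \<cdot>\<^sub>m binary_qf 1 (d + d / z)) y"
      using z(1) by (simp add: xy qf_value_smult [of _ 2]) (simp add: field_simps power2_eq_square)
  qed auto
  then show ?thesis
    by - (rule isometric_sym, simp add: isometric_iff_embeds)
qed

text \<open>
  An isotropic vector yields a root \<open>t\<close> of \<open>t\<^sup>2 + t = d\<close>, and then
  \<open>x\<^sup>2 + xy + dy\<^sup>2 = (x + ty)(x + (1+t)y)\<close>.
\<close>

lemma isotropic_binary_imp_hyperbolic:
  assumes "isotropic (binary_qf 1 (d :: 'a))"
  shows "hyperbolic (binary_qf 1 d)"
proof -
  from assms obtain v where "v \<in> carrier_vec 2" and v: "v \<noteq> 0\<^sub>v 2" "qf_value (binary_qf 1 d) v = 0"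
    by (auto simp: isotropic_def)
  then obtain p q where "v = vec2 p q"
    by (elim vec2_cases)
  with v have pq: "p\<^sup>2 + p * q + d * q\<^sup>2 = 0" and "p \<noteq> 0 \<or> q \<noteq> 0"
    by auto
  then have q: "q \<noteq> 0"
    by auto
  define t where "t = p / q"
  have d: "d = t\<^sup>2 + t"
  proof -
    have "d * q\<^sup>2 = p\<^sup>2 + p * q"
      using pq by (simp add: eq_neg_iff_add_eq_0 [symmetric] uminus_eq)
    then show ?thesis
      using q by (simp add: t_def field_simps power2_eq_square)
  qed
  have "binary_qf 1 d \<lesssim> binary_qf 0 0"
  proof (rule embedsI [of _ 2 _ 2 "mat2 1 t 1 (1 + t)"])
    fix z :: "'a vec" assume z: "z \<in> carrier_vec 2"
    then obtain x y where xy: "z = vec2 x y"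
      by (rule vec2_cases)
    show "qf_value (binary_qf 0 0) (mat2 1 t 1 (1 + t) *\<^sub>v z) = qf_value (binary_qf 1 d) z"
      by (simp add: xy d) (simp add: algebra_simps power2_eq_square)
    show "z = 0\<^sub>v 2" if "mat2 1 t 1 (1 + t) *\<^sub>v z = 0\<^sub>v 2"
      using that by (auto simp: xy add_eq_0_iff uminus_eq algebra_simps)
  qed auto
  then have "binary_qf 1 d \<simeq> hyp_sum 1"
    by (simp add: isometric_iff_embeds del: diag_block_mat.simps)
  then show ?thesis
    unfolding hyperbolic_def by blast
qed

text \<open>
  If \<open>A\<close> is anisotropic and \<open>\<langle>\<langle>a\<rangle>\<rangle>A\<close> is not, then \<open>a\<close> is a quotient of two values of \<open>A\<close>. By roundness
  it can be replaced by \<open>1\<close>, and \<open>A \<perp> A\<close> is hyperbolic.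
\<close>

lemma isotropic_pfs_imp_hyperbolic:
  assumes "0 \<notin> set as" "isotropic (pfs as (binary_qf 1 (d :: 'a)))"
  shows "hyperbolic (pfs as (binary_qf 1 d))"
  using assms
proof (induction as)
  case Nil
  then show ?case by (simp add: isotropic_binary_imp_hyperbolic)
next
  case (Cons a as)
  let ?A = "pfs as (binary_qf 1 d)"
  have A: "?A \<in> carrier_mat (2 ^ length as * 2) (2 ^ length as * 2)"
    by (intro pfs_carrier) simp
  show ?case
  proof (cases "isotropic ?A")
    case True
    then have "hyperbolic ?A"
      using Cons by auto
    then show ?thesis
      using hyperbolic_pfs [of ?A "[a]"] Cons.prems by simp
  next
    case False
    obtain u v where uv: "u + a * v = 0" "u \<noteq> 0" "v \<noteq> 0" "represents ?A u" "represents ?A v"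
      using isotropic_dblE [OF _ A False] Cons.prems by auto
    have r: "u \<cdot>\<^sub>m ?A \<simeq> ?A" "v \<cdot>\<^sub>m ?A \<simeq> ?A"
      using round_pfs [of as d] Cons.prems uv by (auto simp: round_form_def)
    have "u = a * v"
      using uv(1) by (simp add: add_eq_0_iff uminus_eq)
    then have "dbl a ?A \<simeq> dbl 1 ?A"
      using dbl_mult_similarity [OF r(1), of 1] dbl_mult_similarity [OF r(2), of a]
      by (simp add: mult.commute) (metis isometric_sym isometric_trans)
    then show ?thesis
      using hyperbolic_dbl_one_pfs [of as d] hyperbolic_cong Cons.prems by auto
  qed
qed

end

section \<open>Totally isotropic subspaces and hyperbolic planes\<close>

lemma exists_hyperplane_parametrization:
  assumes "l \<in> carrier_vec (Suc d)"
  shows "\<exists>K \<in> carrier_mat (Suc d) d. (\<forall>x \<in> carrier_vec d. K *\<^sub>v x = 0\<^sub>v (Suc d) \<longrightarrow> x = 0\<^sub>v d) \<and>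
    (\<forall>x \<in> carrier_vec d. l \<bullet> (K *\<^sub>v x) = (0 :: 'a::field))"
  using assms
proof (induction d arbitrary: l)
  case 0
  show ?case
    using 0 by (intro bexI [of _ "0\<^sub>m 1 0"]) auto
next
  case (Suc d)
  then have "l \<in> carrier_vec (1 + Suc d)"
    by simp
  then obtain l0 l' where l: "l = l0 @\<^sub>v l'" and l0: "l0 \<in> carrier_vec 1" and l': "l' \<in> carrier_vec (Suc d)"
    by (rule vec_append_cases)
  show ?case
  proof (cases "l0 $ 0 = 0")
    case True
    then have "l0 = 0\<^sub>v 1"
      using l0 by (intro eq_vecI) auto
    obtain K where K: "K \<in> carrier_mat (Suc d) d"
      "\<And>x. x \<in> carrier_vec d \<Longrightarrow> K *\<^sub>v x = 0\<^sub>v (Suc d) \<Longrightarrow> x = 0\<^sub>v d"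
      "\<And>x. x \<in> carrier_vec d \<Longrightarrow> l' \<bullet> (K *\<^sub>v x) = 0"
      using Suc.IH [OF l'] by blast
    let ?K = "four_block_mat (1\<^sub>m 1) (0\<^sub>m 1 d) (0\<^sub>m (Suc d) 1) K"
    have "(?K *\<^sub>v z = 0\<^sub>v (1 + Suc d) \<longrightarrow> z = 0\<^sub>v (1 + d)) \<and> l \<bullet> (?K *\<^sub>v z) = 0" if "z \<in> carrier_vec (1 + d)" for z
    proof -
      from that obtain x y where z: "z = x @\<^sub>v y" and x: "x \<in> carrier_vec 1" and y: "y \<in> carrier_vec d"
        by (rule vec_append_cases)
      have "?K *\<^sub>v z = (1\<^sub>m 1 *\<^sub>v x + 0\<^sub>m 1 d *\<^sub>v y) @\<^sub>v (0\<^sub>m (Suc d) 1 *\<^sub>v x + K *\<^sub>v y)"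
        unfolding z by (rule four_block_mat_mult_vec) (use K x y in auto)
      then have Kz: "?K *\<^sub>v z = x @\<^sub>v (K *\<^sub>v y)" and Ky: "K *\<^sub>v y \<in> carrier_vec (Suc d)"
        using K x y by auto
      show ?thesis
        unfolding Kz unfolding z l zero_vec_append [OF x]
        using scalar_prod_append [OF l0 l' x Ky] x y K(2,3) \<open>l0 = 0\<^sub>v 1\<close> by auto
    qed
    moreover have "?K \<in> carrier_mat (Suc (Suc d)) (Suc d)"
      using four_block_carrier_mat [OF one_carrier_mat K(1), of 1] by simp
    ultimately show ?thesis
      by (intro bexI [of _ ?K]) auto
  next
    case False
    let ?r = "(- inverse (l0 $ 0)) \<cdot>\<^sub>v l'"
    let ?K = "mat_of_row ?r @\<^sub>r 1\<^sub>m (Suc d)"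
    have R: "mat_of_row ?r \<in> carrier_mat 1 (Suc d)"
      using l' by auto
    have K: "?K \<in> carrier_mat (1 + Suc d) (Suc d)"
      using R by (intro carrier_append_rows) auto
    have "(?K *\<^sub>v z = 0\<^sub>v (1 + Suc d) \<longrightarrow> z = 0\<^sub>v (Suc d)) \<and> l \<bullet> (?K *\<^sub>v z) = 0" if z: "z \<in> carrier_vec (Suc d)" for z
    proof -
      let ?x = "mat_of_row ?r *\<^sub>v z"
      have x: "?x \<in> carrier_vec 1"
        using R z by auto
      have Kz: "?K *\<^sub>v z = ?x @\<^sub>v z"
        using mat_mult_append [OF R one_carrier_mat z] z by simp
      have "l0 \<bullet> ?x + l' \<bullet> z = 0"
        using l0 l' z False x by (simp add: scalar_prod_def [of l0] row_mat_of_row)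
      then show ?thesis
        unfolding Kz unfolding l zero_vec_append [OF x] using scalar_prod_append [OF l0 l' x z] by simp
    qed
    then show ?thesis
      using K by (intro bexI [of _ ?K]) auto
  qed
qed

text \<open>
  Let \<open>l\<^sub>1, l\<^sub>2\<close> be the coordinates in the plane of a totally isotropic space of dimension \<open>d + 1\<close>, and
  \<open>N\<close> its projection to \<open>B\<close>. On the hyperplane \<open>l\<^sub>2 = 0\<close> the values of \<open>B\<close> vanish because the plane
  contributes \<open>l\<^sub>1l\<^sub>2 = 0\<close>. The projection is injective there unless the space contains \<open>(1,0,0)\<close>; but
  that vector is orthogonal only to vectors with \<open>l\<^sub>2 = 0\<close>, so \<open>l\<^sub>2\<close> would vanish identically. In that
  case the hyperplane \<open>l\<^sub>1 = 0\<close> serves instead.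
\<close>

lemma zero_embeds_cancel_plane:
  assumes emb: "0\<^sub>m (Suc d) (Suc d) \<lesssim> binary_qf 0 0 \<perp> B" and B: "B \<in> carrier_mat t (t :: nat)"
  shows "0\<^sub>m d d \<lesssim> (B :: 'a::field mat)"
proof -
  let ?H = "binary_qf 0 0 :: 'a mat"
  obtain M where M: "M \<in> carrier_mat (2 + t) (Suc d)"
    and inj: "\<And>x. x \<in> carrier_vec (Suc d) \<Longrightarrow> M *\<^sub>v x = 0\<^sub>v (2 + t) \<Longrightarrow> x = 0\<^sub>v (Suc d)"
    and val: "\<And>x. x \<in> carrier_vec (Suc d) \<Longrightarrow> qf_value (?H \<perp> B) (M *\<^sub>v x) = 0"
  proof (rule embedsE [OF emb], goal_cases)
    case (1 n m P)
    have "n = Suc d" "m = 2 + t"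
      using 1(2,3) B by auto
    then show ?case
      using 1(1) [of P] 1(4-) by (auto simp: qf_value_def)
  qed
  define l2 where "l2 = row M 1"
  define l1 where "l1 = row M 0"
  define N where "N = mat t (Suc d) (\<lambda>(i, j). M $$ (i + 2, j))"
  have l: "l1 \<in> carrier_vec (Suc d)" "l2 \<in> carrier_vec (Suc d)" and N: "N \<in> carrier_mat t (Suc d)"
    using row_carrier [of M] carrier_matD(2) [OF M] by (simp_all add: l1_def l2_def N_def)
  have split: "M *\<^sub>v x = vec2 (l1 \<bullet> x) (l2 \<bullet> x) @\<^sub>v (N *\<^sub>v x)" if "x \<in> carrier_vec (Suc d)" for x
  proof (rule eq_vecI)
    fix i assume "i < dim_vec (vec2 (l1 \<bullet> x) (l2 \<bullet> x) @\<^sub>v (N *\<^sub>v x))"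
    then have i: "i < 2 + t"
      using N by (simp add: vec2_def)
    have "row M i = row N (i - 2)" if "\<not> i < 2"
    proof -
      have "Suc (Suc (i - 2)) = i"
        using that by simp
      then show ?thesis
        using that i M by (intro eq_vecI) (auto simp: N_def)
    qed
    then show "(M *\<^sub>v x) $ i = (vec2 (l1 \<bullet> x) (l2 \<bullet> x) @\<^sub>v (N *\<^sub>v x)) $ i"
      using i M N by (auto simp: vec2_def l1_def l2_def less_2_cases_iff)
  qed (use M N in \<open>simp add: vec2_def\<close>)
  have val': "(l1 \<bullet> x) * (l2 \<bullet> x) + qf_value B (N *\<^sub>v x) = 0" if x: "x \<in> carrier_vec (Suc d)" for x
    using val [OF x] B N x unfolding split [OF x] by (simp add: qf_value_orth_sum [OF binary_qf_carrier B])
  have inj': "x = 0\<^sub>v (Suc d)" if x: "x \<in> carrier_vec (Suc d)" "l1 \<bullet> x = 0" "l2 \<bullet> x = 0" "N *\<^sub>v x = 0\<^sub>v t" for x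
    using inj [OF x(1)] unfolding split [OF x(1)] zero_vec_append [OF vec2_carrier] by (simp add: x)
  define l where "l = (if l2 = 0\<^sub>v (Suc d) then l1 else l2)"
  have key: "qf_value B (N *\<^sub>v x) = 0 \<and> (N *\<^sub>v x = 0\<^sub>v t \<longrightarrow> x = 0\<^sub>v (Suc d))"
    if x: "x \<in> carrier_vec (Suc d)" and lx: "l \<bullet> x = 0" for x
  proof (cases "l2 = 0\<^sub>v (Suc d)")
    case True
    then have "l1 \<bullet> x = 0" "l2 \<bullet> x = 0"
      using lx x by (auto simp: l_def)
    then show ?thesis
      using val' [OF x] inj' [OF x] by auto
  next
    case False
    then have l2x: "l2 \<bullet> x = 0"
      using lx by (simp add: l_def)
    have "x = 0\<^sub>v (Suc d)" if Nx: "N *\<^sub>v x = 0\<^sub>v t"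
    proof -
      obtain i where i: "i < Suc d" "l2 $ i \<noteq> 0"
        using False l by (auto simp: vec_eq_iff)
      let ?u = "unit_vec (Suc d) i :: 'a vec"
      have "l2 \<bullet> ?u \<noteq> 0"
        using i l by simp
      moreover have "(l1 \<bullet> ?u) * (l2 \<bullet> ?u) + qf_value B (N *\<^sub>v ?u) = 0"
        by (rule val') simp
      moreover have "(l1 \<bullet> (?u + x)) * (l2 \<bullet> (?u + x)) + qf_value B (N *\<^sub>v (?u + x)) = 0"
        using x by (intro val') auto
      then have "(l1 \<bullet> ?u + l1 \<bullet> x) * (l2 \<bullet> ?u) + qf_value B (N *\<^sub>v ?u) = 0"
        using x l N Nx l2x
        by (simp add: scalar_prod_add_distrib [of _ "Suc d"] mult_add_distrib_mat_vec [of _ t "Suc d"] del: scalar_prod_right_unit)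
      ultimately have "l1 \<bullet> x = 0"
        by (simp add: algebra_simps add_eq_0_iff del: scalar_prod_right_unit)
      then show ?thesis
        using inj' x l2x Nx by blast
    qed
    then show ?thesis
      using val' [OF x] l2x by simp
  qed
  have "l \<in> carrier_vec (Suc d)"
    using l by (simp add: l_def)
  from exists_hyperplane_parametrization [OF this] obtain K where K: "K \<in> carrier_mat (Suc d) d"
    "\<And>x. x \<in> carrier_vec d \<Longrightarrow> K *\<^sub>v x = 0\<^sub>v (Suc d) \<Longrightarrow> x = 0\<^sub>v d"
    "\<And>x. x \<in> carrier_vec d \<Longrightarrow> l \<bullet> (K *\<^sub>v x) = 0"
    by blast
  show ?thesis
  proof (rule embedsI [of _ d _ t "N * K"])
    fix x :: "'a vec" assume x: "x \<in> carrier_vec d"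
    then have Kx: "K *\<^sub>v x \<in> carrier_vec (Suc d)" and eq: "(N * K) *\<^sub>v x = N *\<^sub>v (K *\<^sub>v x)"
      using K(1) N by auto
    show "qf_value B ((N * K) *\<^sub>v x) = qf_value (0\<^sub>m d d) x"
      unfolding eq using key [OF Kx K(3) [OF x]] x by (simp add: qf_value_def)
    show "x = 0\<^sub>v d" if "(N * K) *\<^sub>v x = 0\<^sub>v t"
      using that key [OF Kx K(3) [OF x]] K(2) [OF x] unfolding eq by blast
  qed (use B N K in auto)
qed

lemma zero_embeds_cancel_hyp_sum:
  assumes "B \<in> carrier_mat t t"
  shows "0\<^sub>m (r + d) (r + d) \<lesssim> hyp_sum r \<perp> B \<Longrightarrow> 0\<^sub>m d d \<lesssim> B"
proof (induction r)
  case 0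
  then show ?case by simp
next
  case (Suc r)
  have "hyp_sum r \<perp> B \<in> carrier_mat (2 * r + t) (2 * r + t)"
    using assms by auto
  moreover have "0\<^sub>m (Suc (r + d)) (Suc (r + d)) \<lesssim> binary_qf 0 0 \<perp> (hyp_sum r \<perp> B)"
    using Suc.prems by (simp only: hyp_sum_Suc orth_sum_assoc add_Suc)
  ultimately show ?case
    using Suc.IH zero_embeds_cancel_plane by blast
qed

lemma qf_value_one: "x \<in> carrier_vec 1 \<Longrightarrow> qf_value (1\<^sub>m 1) x = (x $ 0)\<^sup>2"
  by (simp add: qf_value_def scalar_prod_def power2_eq_square)

lemma zero_embeds_imp_isotropic:
  assumes "0\<^sub>m 1 1 \<lesssim> A"
  shows "isotropic A"
proof (rule embeds_isotropic [OF assms])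
  have "unit_vec 1 0 \<noteq> (0\<^sub>v 1 :: 'a vec)"
    by (auto simp: vec_eq_iff)
  then show "isotropic (0\<^sub>m 1 1 :: 'a mat)"
    unfolding isotropic_def by (intro bexI [of _ "unit_vec 1 0"]) (auto simp: qf_value_def)
qed

text \<open>
  The complement of \<open>A\<close> in \<open>\<langle>\<langle>a\<^sub>1,\<dots>,a\<^sub>r\<rangle>\<rangle>A\<close>, see \<open>pfs_eq_pure_part\<close>.
\<close>

fun pure_part :: "'a::field list \<Rightarrow> 'a mat \<Rightarrow> 'a mat" where
  "pure_part [] A = 0\<^sub>m 0 0"
| "pure_part (a # as) A = pure_part as A \<perp> a \<cdot>\<^sub>m pfs as A"

lemma pfs_eq_pure_part: "pfs as A = A \<perp> pure_part as A"
proof (induction as)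
  case (Cons a as)
  have "pfs (a # as) A = pfs as A \<perp> a \<cdot>\<^sub>m pfs as A"
    by (simp add: dbl_def [of a])
  also have "\<dots> = A \<perp> pure_part (a # as) A"
    by (simp add: orth_sum_assoc [symmetric] Cons.IH [symmetric])
  finally show ?case .
qed simp

lemma pure_part_carrier [simp]:
  assumes "A \<in> carrier_mat n n"
  shows "pure_part as A \<in> carrier_mat ((2 ^ length as - 1) * n) ((2 ^ length as - 1) * n)"
proof -
  have d: "dim_row (pure_part as A) = (2 ^ length as - 1) * n" "dim_col (pure_part as A) = (2 ^ length as - 1) * n"
    using arg_cong [OF pfs_eq_pure_part [of as A], of dim_row] arg_cong [OF pfs_eq_pure_part [of as A], of dim_col] assms
    by (auto simp: diff_mult_distrib)
  then show ?thesis
    by (intro carrier_matI)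
qed

lemma embeds_pure_part: "A \<lesssim> B \<Longrightarrow> pure_part as A \<lesssim> pure_part as B"
  by (induction as) (auto intro!: embeds_orth_sum_mono embeds_smult embeds_pfs embeds_refl)

section \<open>Inseparable linkage forces an isotropic invariant\<close>

definition additive_form :: "'a::field mat \<Rightarrow> bool" where
  "additive_form A \<longleftrightarrow> (\<forall>x \<in> carrier_vec (dim_row A). \<forall>y \<in> carrier_vec (dim_row A).
     qf_value A (x + y) = qf_value A x + qf_value A y)"

lemma additive_dbl:
  assumes A: "(A :: 'a::field mat) \<in> carrier_mat n n" and add: "additive_form A"
  shows "additive_form (dbl a A)"
  unfolding additive_form_def
proof (intro ballI)
  fix x y :: "'a vec" assume "x \<in> carrier_vec (dim_row (dbl a A))" "y \<in> carrier_vec (dim_row (dbl a A))"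
  then have "x \<in> carrier_vec (n + n)" "y \<in> carrier_vec (n + n)"
    using A by (auto simp: mult_2)
  then obtain x1 x2 y1 y2 where xy: "x = x1 @\<^sub>v x2" "y = y1 @\<^sub>v y2"
    and c: "x1 \<in> carrier_vec n" "x2 \<in> carrier_vec n" "y1 \<in> carrier_vec n" "y2 \<in> carrier_vec n"
    by (metis vec_append_cases)
  have "x + y = (x1 + y1) @\<^sub>v (x2 + y2)"
    unfolding xy using c by (intro append_vec_add) auto
  moreover have add': "qf_value A (u + v) = qf_value A u + qf_value A v" if "u \<in> carrier_vec n" "v \<in> carrier_vec n" for u v
    using that add A by (auto simp: additive_form_def)
  ultimately show "qf_value (dbl a A) (x + y) = qf_value (dbl a A) x + qf_value (dbl a A) y"
    using A c by (simp add: xy dbl_def qf_value_orth_sum [of _ n _ n] qf_value_smult [of _ n] add' algebra_simps)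
qed

lemma additive_pfs:
  assumes "A \<in> carrier_mat n n" "additive_form A"
  shows "additive_form (pfs as A)"
  by (induction as) (auto intro!: assms additive_dbl pfs_carrier)

lemma one_embeds_binary: "1\<^sub>m 1 \<lesssim> binary_qf 1 (d :: 'a::field)"
proof (rule embedsI [of _ 1 _ 2 "mat 2 1 (\<lambda>(i, j). if i = 0 then 1 else 0)"])
  fix x :: "'a vec" assume x: "x \<in> carrier_vec 1"
  have eq: "mat 2 1 (\<lambda>(i, j). if i = 0 then 1 else 0) *\<^sub>v x = vec2 (x $ 0) 0"
    using x by (intro eq_vecI) (auto simp: vec2_def scalar_prod_def less_2_cases_iff)
  show "qf_value (binary_qf 1 d) (mat 2 1 (\<lambda>(i, j). if i = 0 then 1 else 0) *\<^sub>v x) = qf_value (1\<^sub>m 1) x"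
    unfolding eq using x by (simp add: qf_value_one del: One_nat_def)
  show "x = 0\<^sub>v 1" if "mat 2 1 (\<lambda>(i, j). if i = 0 then 1 else 0) *\<^sub>v x = 0\<^sub>v 2"
    using that x unfolding eq by (auto intro!: eq_vecI)
qed auto

context char_two
begin

text \<open>
  The diagonal is totally isotropic.
\<close>

lemma zero_embeds_double:
  assumes A: "(A :: 'a mat) \<in> carrier_mat n n"
  shows "0\<^sub>m n n \<lesssim> A \<perp> A"
proof -
  have "0\<^sub>m n n \<perp> 0\<^sub>m 0 0 \<lesssim> A \<perp> A"
    by (rule embeds_blockI [of _ n _ 0 _ n _ n "1\<^sub>m n" "0\<^sub>m n 0" "1\<^sub>m n" "0\<^sub>m n 0"])
      (use A in \<open>auto simp: qf_value_def [of "0\<^sub>m _ _"]\<close>)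
  then show ?thesis by simp
qed

lemma additive_one: "additive_form (1\<^sub>m 1 :: 'a mat)"
proof -
  have "(u + v)\<^sup>2 = u\<^sup>2 + v\<^sup>2" for u v :: 'a
    by (simp add: power2_eq_square algebra_simps)
  then show ?thesis
    by (simp add: additive_form_def qf_value_one del: One_nat_def)
qed

text \<open>
  The map \<open>(x, y) \<mapsto> (x + y, y)\<close> changes \<open>A(x) + A(y)\<close> only by \<open>2A(y) = 0\<close>. Compared with
  \<open>zero_embeds_double\<close>, the diagonal is now complemented by an orthogonal copy of \<open>A\<close>; this is
  where total singularity of the common bilinear factor enters.
\<close>

lemma additive_shear:
  assumes A: "(A :: 'a mat) \<in> carrier_mat n n" and add: "additive_form A"
  shows "A \<perp> 0\<^sub>m n n \<lesssim> A \<perp> A"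
proof (rule embeds_blockI [of _ n _ n _ n _ n "1\<^sub>m n" "1\<^sub>m n" "0\<^sub>m n n" "1\<^sub>m n"])
  fix x y :: "'a vec" assume xy: "x \<in> carrier_vec n" "y \<in> carrier_vec n"
  then have "qf_value A (x + y) = qf_value A x + qf_value A y"
    using A add by (auto simp: additive_form_def)
  then show "qf_value A (1\<^sub>m n *\<^sub>v x + 1\<^sub>m n *\<^sub>v y) + qf_value A (0\<^sub>m n n *\<^sub>v x + 1\<^sub>m n *\<^sub>v y)
    = qf_value A x + qf_value (0\<^sub>m n n) y"
    using xy by (simp add: qf_value_def [of "0\<^sub>m n n"] add.assoc)
qed (use A in auto)

text \<open>
  The equation \<open>length es = Suc (length cs)\<close> says that the common bilinear factor \<open>\<langle>\<langle>es\<rangle>\<rangle>\<close> and the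
  common quadratic factor \<open>P\<close> have the same dimension \<open>n\<close>. Thus \<open>P \<perp> P\<close> absorbs at most \<open>n\<close> of the
  \<open>n + 1\<close> dimensions of the totally isotropic subspace that is constructed here.
\<close>

lemma inseparable_linkage_isotropic:
  assumes cs: "0 \<notin> set cs" and len: "length es = Suc (length cs)"
    and iso1: "pfs es (pfs fs (binary_qf 1 d\<^sub>1)) \<lesssim> pfs as (pfs cs (binary_qf 1 (d :: 'a)))"
    and iso2: "pfs es (pfs gs (binary_qf 1 d\<^sub>2)) \<lesssim> pfs bs (pfs cs (binary_qf 1 d))"
  shows "isotropic (pfs as (pfs bs (pfs cs (binary_qf 1 d))))"
proof -
  define P where "P = pfs cs (binary_qf 1 d)"
  define T where "T = pfs es (1\<^sub>m 1 :: 'a mat)"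
  define n :: nat where "n = 2 ^ length es"
  let ?R1 = "pure_part as P" and ?R2 = "pure_part bs P"
  have P: "P \<in> carrier_mat n n"
    using pfs_carrier [OF binary_qf_carrier, of cs 1 d] by (simp add: P_def n_def len mult.commute)
  have T: "T \<in> carrier_mat n n"
    using pfs_carrier [OF one_carrier_mat, of es 1] by (simp add: T_def n_def)
  have emb: "T \<lesssim> pfs es (pfs hs (binary_qf 1 e))" for hs e
    unfolding T_def by (intro embeds_pfs embeds_trans [OF one_embeds_binary embeds_pfs_self [OF binary_qf_carrier]])
  have 1: "1\<^sub>m 1 \<lesssim> P" "1\<^sub>m 1 \<lesssim> T"
    unfolding P_def T_def
    by (rule embeds_trans [OF one_embeds_binary embeds_pfs_self [OF binary_qf_carrier]],
        rule embeds_pfs_self [OF one_carrier_mat])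
  obtain r1 r2 where R: "?R1 \<in> carrier_mat r1 r1" "?R2 \<in> carrier_mat r2 r2"
    using P pure_part_carrier by blast
  \<comment> \<open>The diagonal of \<open>T \<perp> T\<close> gives \<open>n\<close> dimensions, the vector \<open>1\<close> in \<open>P\<close> and \<open>T\<close> one more.\<close>
  have "0\<^sub>m (n + 1) (n + 1) = 0\<^sub>m 1 1 \<perp> (0\<^sub>m n n :: 'a mat)"
    by (rule eq_matI) (auto simp: orth_sum_def)
  also have "\<dots> \<lesssim> (1\<^sub>m 1 \<perp> 1\<^sub>m 1) \<perp> 0\<^sub>m n n"
    by (intro embeds_orth_sum_mono zero_embeds_double embeds_refl) auto
  also have "\<dots> = 1\<^sub>m 1 \<perp> 1\<^sub>m 1 \<perp> 0\<^sub>m n n"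
    by (rule orth_sum_assoc)
  also have "\<dots> \<lesssim> P \<perp> T \<perp> 0\<^sub>m n n"
    by (intro embeds_orth_sum_mono 1 embeds_refl) auto
  also have "\<dots> \<lesssim> P \<perp> T \<perp> T"
    using P T additive_pfs [OF one_carrier_mat additive_one, of es]
    by (intro embeds_orth_sum_mono additive_shear embeds_refl) (auto simp: T_def)
  also have "\<dots> \<lesssim> P \<perp> pfs as P \<perp> pfs bs P"
    using P embeds_trans [OF emb iso1] embeds_trans [OF emb iso2]
    by (intro embeds_orth_sum_mono embeds_refl) (auto simp: P_def)
  \<comment> \<open>The copies of \<open>P\<close> inside \<open>\<psi>\<^sub>1\<close> and \<open>\<psi>\<^sub>2\<close> form \<open>n\<close> hyperbolic planes.\<close>
  also have "\<dots> = P \<perp> (P \<perp> ?R1) \<perp> (P \<perp> ?R2)"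
    by (simp only: pfs_eq_pure_part)
  also have "\<dots> \<simeq> P \<perp> (P \<perp> P) \<perp> (?R1 \<perp> ?R2)"
    using P R by (intro isometric_orth_sum orth_sum_swap_middle isometric_refl)
  also have "\<dots> = (P \<perp> P) \<perp> (P \<perp> ?R1 \<perp> ?R2)"
    by (simp add: orth_sum_assoc)
  also have "\<dots> \<simeq> hyp_sum n \<perp> (P \<perp> ?R1 \<perp> ?R2)"
  proof (intro isometric_orth_sum isometric_refl)
    have "hyperbolic (P \<perp> P)"
      using hyperbolic_dbl_one_pfs [OF cs, of d] by (simp add: dbl_def [of _ "pfs _ _"] P_def)
    then show "P \<perp> P \<simeq> hyp_sum n"
      using P by (intro hyperbolic_imp_isometric) auto
  qed (use P R in auto)
  finally have "0\<^sub>m (n + 1) (n + 1) \<lesssim> hyp_sum n \<perp> (P \<perp> ?R1 \<perp> ?R2)"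
    .
  then have "0\<^sub>m 1 1 \<lesssim> P \<perp> ?R1 \<perp> ?R2"
    using P R by (elim zero_embeds_cancel_hyp_sum [rotated]) auto
  also have "\<dots> \<simeq> P \<perp> ?R2 \<perp> ?R1"
    using P R by (intro isometric_orth_sum isometric_orth_sum_commute isometric_refl)
  also have "\<dots> = pfs bs P \<perp> ?R1"
    by (simp only: orth_sum_assoc pfs_eq_pure_part)
  also have "\<dots> \<lesssim> pfs bs P \<perp> pure_part as (pfs bs P)"
    using P by (intro embeds_orth_sum_mono embeds_pure_part embeds_pfs_self embeds_refl) auto
  also have "\<dots> = pfs as (pfs bs P)"
    by (simp only: pfs_eq_pure_part)
  finally have "0\<^sub>m 1 1 \<lesssim> pfs as (pfs bs P)" .
  then show ?thesis
    unfolding P_def by (rule zero_embeds_imp_isotropic)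
qed

end

section \<open>Common bilinear factors from an isotropic invariant\<close>

lemma inseparably_linked_sym: "inseparably_linked k \<psi>\<^sub>1 \<psi>\<^sub>2 \<Longrightarrow> inseparably_linked k \<psi>\<^sub>2 \<psi>\<^sub>1"
  unfolding inseparably_linked_def by blast

context char_two
begin

text \<open>
  If the form is anisotropic, \<open>a = u/v = v\<^sup>-\<^sup>2(vu)\<close> for values \<open>u, v\<close>, and \<open>vu\<close> is a value by roundness. If it
  is isotropic, it is hyperbolic and represents everything.
\<close>

lemma represents_slot_of_isotropic_dbl:
  assumes as: "0 \<notin> set as" and a: "a \<noteq> 0"
    and iso: "isotropic (dbl a (pfs as (binary_qf 1 (d :: 'a))))"
  shows "represents (pfs as (binary_qf 1 d)) a"
proof -
  let ?A = "pfs as (binary_qf 1 d)"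
  note A = pfs_carrier [OF binary_qf_carrier, of as 1 d]
  show ?thesis
  proof (cases "isotropic ?A")
    case True
    then show ?thesis
      using isotropic_pfs_imp_hyperbolic [OF as] by (intro hyperbolic_represents) auto
  next
    case False
    obtain u v where uv: "u + a * v = 0" "u \<noteq> 0" "v \<noteq> 0" "represents ?A u" "represents ?A v"
      using isotropic_dblE [OF iso A False a] .
    then have "v \<cdot>\<^sub>m ?A \<simeq> ?A"
      using round_pfs [OF as, of d] by (auto simp: round_form_def)
    then have "represents ?A (v * u)"
      using represents_smultI [OF uv(4) A] embeds_represents isometric_imp_embeds by blast
    then have "represents ?A ((1 / v)\<^sup>2 * (v * u))"
      by (rule represents_mult_square [OF A])
    moreover have "u = a * v"
      using uv(1) by (simp add: add_eq_0_iff uminus_eq)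
    then have "(1 / v)\<^sup>2 * (v * u) = a"
      using uv(3) by (simp add: power2_eq_square)
    ultimately show ?thesis
      by simp
  qed
qed

text \<open>
  With \<open>Q = \<langle>\<langle>bs\<rangle>\<rangle>P\<close>, a value of the complement of \<open>P\<close> in \<open>\<langle>\<langle>b\<rangle>\<rangle>Q\<close> is \<open>w = w\<^sub>1 + bt\<^sub>2\<close>, where \<open>t\<^sub>2\<close> is a value of
  \<open>Q\<close> and \<open>w\<^sub>1\<close> one of the complement of \<open>P\<close> in \<open>Q\<close>. Roundness of \<open>Q\<close> turns the slot \<open>b\<close> into \<open>bt\<^sub>2\<close>, by
  induction \<open>w\<^sub>1\<close> is a slot of \<open>Q\<close>, and \<open>dbl_dbl_add\<close> adds the two slots.
\<close>

lemma represents_pfs_pure_slot: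
  fixes d :: 'a
  defines "P cs \<equiv> pfs cs (binary_qf 1 d)"
  assumes "0 \<notin> set cs" "0 \<notin> set bs" "represents (pfs bs (P cs)) t"
  shows "\<exists>u w. t = u + w \<and> represents (P cs) u \<and> (w = 0 \<or>
    (\<exists>bs'. 0 \<notin> set bs' \<and> pfs bs (P cs) \<simeq> pfs (w # bs') (P cs)))"
  using assms(3,4)
proof (induction bs arbitrary: t)
  case Nil
  then show ?case by (intro exI [of _ t] exI [of _ 0]) auto
next
  case (Cons b bs)
  let ?Q = "pfs bs (P cs)"
  have Pc: "P cs \<in> carrier_mat (2 ^ length cs * 2) (2 ^ length cs * 2)"
    unfolding P_def by (intro pfs_carrier) simp
  note Q = pfs_carrier [OF Pc]
  have b: "b \<noteq> 0" "0 \<notin> set bs"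
    using Cons.prems by auto
  obtain t1 t2 where t: "t = t1 + b * t2" "represents ?Q t1" "represents ?Q t2"
    using represents_dblE [OF _ Q] Cons.prems by (metis foldr_Cons o_apply)
  obtain u w1 where uw: "t1 = u + w1" "represents (P cs) u"
    and w1: "w1 = 0 \<or> (\<exists>bs'. 0 \<notin> set bs' \<and> ?Q \<simeq> pfs (w1 # bs') (P cs))"
    using Cons.IH [OF b(2) t(2)] by blast
  define w where "w = w1 + b * t2"
  have "\<exists>bs'. 0 \<notin> set bs' \<and> dbl b ?Q \<simeq> pfs (w # bs') (P cs)" if w: "w \<noteq> 0"
  proof (cases "t2 = 0")
    case True
    then have "w1 = w"
      by (simp add: w_def)
    then obtain bs' where bs': "0 \<notin> set bs'" "?Q \<simeq> dbl w (pfs bs' (P cs))"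
      using w1 w by auto
    have "dbl b ?Q \<simeq> dbl b (dbl w (pfs bs' (P cs)))"
      by (rule dbl_cong [OF bs'(2)])
    also have "\<dots> \<simeq> pfs (w # b # bs') (P cs)"
      using dbl_commute [OF pfs_carrier [OF Pc]] by simp
    finally show ?thesis
      using bs' b by (intro exI [of _ "b # bs'"]) auto
  next
    case False
    have "round_form ?Q"
      using round_pfs [of "bs @ cs" d] assms(2) b by (simp add: P_def)
    then have "t2 \<cdot>\<^sub>m ?Q \<simeq> ?Q"
      using t(3) False by (simp add: round_form_def)
    from isometric_sym [OF dbl_mult_similarity [OF this, of b]]
    have scale: "dbl b ?Q \<simeq> dbl (b * t2) ?Q"
      by (simp add: mult.commute)
    show ?thesis
    proof (cases "w1 = 0")
      case True
      then show ?thesis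
        using scale b by (intro exI [of _ bs]) (auto simp: w_def)
    next
      case False
      then obtain bs' where bs': "0 \<notin> set bs'" "?Q \<simeq> dbl w1 (pfs bs' (P cs))"
        using w1 by auto
      note scale
      also have "dbl (b * t2) ?Q \<simeq> dbl (b * t2) (dbl w1 (pfs bs' (P cs)))"
        by (rule dbl_cong [OF bs'(2)])
      also have "\<dots> \<simeq> dbl (b * t2 + w1) (dbl ((b * t2) * w1) (pfs bs' (P cs)))"
        using w by (intro dbl_dbl_add [OF pfs_carrier [OF Pc]]) (simp add: w_def add.commute)
      finally show ?thesis
        using bs' b False \<open>t2 \<noteq> 0\<close> by (intro exI [of _ "((b * t2) * w1) # bs'"]) (auto simp: w_def add.commute)
    qed
  qed
  then show ?case
    using t uw by (intro exI [of _ u] exI [of _ w]) (auto simp: w_def add.assoc)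
qed

lemma quad_pfister_iff:
  "quad_pfister r (A :: 'a mat) \<longleftrightarrow>
     (\<exists>as d. r = Suc (length as) \<and> 0 \<notin> set as \<and> A \<simeq> pfs as (binary_qf 1 d))"
  by (simp add: quad_pfister_def bil_tensor_qf_bil_pfister_form)

lemma quad_pfister_pfs: "0 \<notin> set as \<Longrightarrow> quad_pfister (Suc (length as)) (pfs as (binary_qf 1 (d :: 'a)))"
  unfolding quad_pfister_iff using isometric_refl [OF pfs_carrier [OF binary_qf_carrier]] by blast

lemma inseparably_linkedI:
  assumes "0 \<notin> set es" "0 \<notin> set fs" "0 \<notin> set gs" "length es = k"
    and "\<psi>\<^sub>1 \<simeq> pfs es (pfs fs (binary_qf 1 d\<^sub>1))" "\<psi>\<^sub>2 \<simeq> pfs es (pfs gs (binary_qf 1 (d\<^sub>2 :: 'a)))"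
  shows "inseparably_linked k \<psi>\<^sub>1 \<psi>\<^sub>2"
proof -
  have "bil_pfister k (bil_pfister_form es)"
    using assms unfolding bil_pfister_def by blast
  then show ?thesis
    unfolding inseparably_linked_def
    using assms quad_pfister_pfs [of fs d\<^sub>1] quad_pfister_pfs [of gs d\<^sub>2]
    by (metis bil_tensor_qf_bil_pfister_form)
qed

lemma inseparably_linkedE:
  assumes "inseparably_linked k \<psi>\<^sub>1 (\<psi>\<^sub>2 :: 'a mat)"
  obtains es fs gs d\<^sub>1 d\<^sub>2 where "length es = k"
    "\<psi>\<^sub>1 \<simeq> pfs es (pfs fs (binary_qf 1 d\<^sub>1))" "\<psi>\<^sub>2 \<simeq> pfs es (pfs gs (binary_qf 1 d\<^sub>2))"
proof -
  from assms obtain es \<pi>\<^sub>1 \<pi>\<^sub>2 fs gs d\<^sub>1 d\<^sub>2 where *: "length es = k"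
    "\<pi>\<^sub>1 \<simeq> pfs fs (binary_qf 1 d\<^sub>1)" "\<pi>\<^sub>2 \<simeq> pfs gs (binary_qf 1 d\<^sub>2)"
    "\<psi>\<^sub>1 \<simeq> pfs es \<pi>\<^sub>1" "\<psi>\<^sub>2 \<simeq> pfs es \<pi>\<^sub>2"
    unfolding inseparably_linked_def bil_pfister_def quad_pfister_iff
    by (auto simp: bil_tensor_qf_bil_pfister_form)
  show ?thesis
    using that [OF *(1) isometric_trans [OF *(4) pfs_cong [OF *(2)]] isometric_trans [OF *(5) pfs_cong [OF *(3)]]] .
qed

lemma is_k_invariantE:
  assumes "is_k_invariant k \<psi>\<^sub>1 \<psi>\<^sub>2 (\<chi> :: 'a mat)"
  obtains as bs cs d where "k = Suc (length cs)" "0 \<notin> set as" "0 \<notin> set bs" "0 \<notin> set cs"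
    "\<psi>\<^sub>1 \<simeq> pfs as (pfs cs (binary_qf 1 d))" "\<psi>\<^sub>2 \<simeq> pfs bs (pfs cs (binary_qf 1 d))"
    "\<chi> \<simeq> pfs as (pfs bs (pfs cs (binary_qf 1 d)))"
proof -
  from assms obtain \<pi> as bs cs d where *: "k = Suc (length cs)" "0 \<notin> set as" "0 \<notin> set bs" "0 \<notin> set cs"
    "\<pi> \<simeq> pfs cs (binary_qf 1 d)" "\<psi>\<^sub>1 \<simeq> pfs as \<pi>" "\<psi>\<^sub>2 \<simeq> pfs bs \<pi>" "\<chi> \<simeq> pfs (as @ bs) \<pi>"
    unfolding is_k_invariant_def bil_pfister_def quad_pfister_iff
    by (auto simp: bil_tensor_qf_bil_pfister_form bil_tensor_bil_pfister_form)
  show ?thesis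
    using that [OF *(1-4) isometric_trans [OF *(6) pfs_cong [OF *(5)]]
        isometric_trans [OF *(7) pfs_cong [OF *(5)]]] isometric_trans [OF *(8) pfs_cong [OF *(5)]]
    by simp
qed

text \<open>
  The bilinear factors in the linkage come without a prescribed number of slots; dimensions
  determine it.
\<close>

lemma length_of_quad_pfister:
  assumes "quad_pfister r (\<psi> :: 'a mat)" "\<psi> \<simeq> pfs as (pfs cs (binary_qf 1 d))"
  shows "r = length as + Suc (length cs)"
proof -
  obtain es e where "r = Suc (length es)" "\<psi> \<simeq> pfs es (binary_qf 1 e)"
    using assms(1) unfolding quad_pfister_iff by blast
  then have "(2 :: nat) ^ r = 2 ^ (length as + Suc (length cs))"
    using isometric_square [OF assms(2)] by (auto dest: isometric_square simp: power_add)
  then show ?thesis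
    by (metis one_less_numeral_iff power_inject_exp semiring_norm(76))
qed

text \<open>
  If \<open>a\<close> is a value of \<open>P\<close> itself, \<open>\<psi>\<^sub>1\<close> is hyperbolic and the last slot of the common bilinear factor
  is taken from \<open>bs\<close>; hence \<open>bs \<noteq> []\<close>. Otherwise that slot is built from the value of the complement of
  \<open>P\<close> in \<open>\<psi>\<^sub>2\<close> that contributes to \<open>a\<close>.
\<close>

lemma inseparably_linked_of_isotropic:
  fixes d :: 'a
  defines "P cs \<equiv> pfs cs (binary_qf 1 d)"
  assumes nz: "a \<noteq> 0" "0 \<notin> set bs" "0 \<notin> set cs" and bs: "bs \<noteq> []"
    and iso: "isotropic (dbl a (pfs bs (P cs)))"
    and \<psi>: "\<psi>\<^sub>1 \<simeq> dbl a (P cs)" "\<psi>\<^sub>2 \<simeq> pfs bs (P cs)"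
  shows "inseparably_linked (Suc (length cs)) \<psi>\<^sub>1 \<psi>\<^sub>2"
proof -
  have Pc: "P cs \<in> carrier_mat (2 ^ length cs * 2) (2 ^ length cs * 2)"
    unfolding P_def by (intro pfs_carrier) simp
  have swap: "dbl w (pfs hs (pfs cs (binary_qf 1 e))) \<simeq> pfs (w # cs) (pfs hs (binary_qf 1 e))" for w hs e
    using dbl_cong [OF pfs_commute [OF binary_qf_carrier]] by simp
  have "represents (pfs bs (P cs)) a"
    using represents_slot_of_isotropic_dbl [of "bs @ cs" a d] nz iso by (simp add: P_def)
  then obtain u w where uw: "a = u + w" "represents (P cs) u"
    and w: "w = 0 \<or> (\<exists>bs'. 0 \<notin> set bs' \<and> pfs bs (P cs) \<simeq> pfs (w # bs') (P cs))"
    using represents_pfs_pure_slot [OF nz(3,2), of d a] unfolding P_def by blast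
  have u: "u \<cdot>\<^sub>m P cs \<simeq> P cs" if "u \<noteq> 0"
    using round_pfs [OF nz(3), of d] uw(2) that by (simp add: P_def round_form_def)
  show ?thesis
  proof (cases "w = 0")
    case True
    then have "dbl a (P cs) \<simeq> dbl 1 (P cs)"
      using dbl_mult_similarity [OF u, of 1] uw(1) nz by simp
    then have h: "hyperbolic \<psi>\<^sub>1"
      using hyperbolic_dbl_one_pfs [OF nz(3), of d] \<psi>(1) hyperbolic_cong P_def by metis
    obtain b hs where b: "bs = b # hs"
      using bs by (cases bs) auto
    show ?thesis
    proof (rule inseparably_linkedI)
      have "isotropic (binary_qf 1 (0 :: 'a))"
        unfolding isotropic_def by (intro bexI [of _ "vec2 0 1"]) auto
      then have "hyperbolic (pfs (b # cs) (binary_qf 1 (0 :: 'a)))"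
        using nz b by (intro hyperbolic_pfs isotropic_binary_imp_hyperbolic) auto
      then show "\<psi>\<^sub>1 \<simeq> pfs (b # cs) (pfs [] (binary_qf 1 0))"
        using h isometric_square [OF \<psi>(1)] by (intro hyperbolic_isometric) (auto simp: P_def)
      show "\<psi>\<^sub>2 \<simeq> pfs (b # cs) (pfs hs (binary_qf 1 d))"
        using isometric_trans [OF \<psi>(2) [unfolded b P_def foldr_Cons o_apply] swap] .
    qed (use nz b in auto)
  next
    case False
    then obtain hs where hs: "0 \<notin> set hs" "pfs bs (P cs) \<simeq> dbl w (pfs hs (P cs))"
      using w by auto
    show ?thesis
    proof (cases "u = 0")
      case True
      show ?thesis
      proof (rule inseparably_linkedI)
        show "\<psi>\<^sub>1 \<simeq> pfs (w # cs) (pfs [] (binary_qf 1 d))"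
          using \<psi>(1) True uw(1) by (simp add: P_def)
        show "\<psi>\<^sub>2 \<simeq> pfs (w # cs) (pfs hs (binary_qf 1 d))"
          using isometric_trans [OF \<psi>(2) [unfolded P_def] isometric_trans [OF hs(2) [unfolded P_def] swap]] .
      qed (use nz hs False in auto)
    next
      case u0: False
      define z where "z = w / u"
      define e where "e = d + d / z"
      have z: "z \<noteq> 0" "1 + z \<noteq> 0" and a: "a = u * (1 + z)" and w: "w = u * z"
        using u0 False nz(1) uw(1) by (auto simp: z_def field_simps)
      have sim: "u \<cdot>\<^sub>m pfs hs (P cs) \<simeq> pfs hs (P cs)"
        unfolding smult_pfs by (rule pfs_cong [OF u [OF u0]])
      show ?thesis
      proof (rule inseparably_linkedI)
        show "\<psi>\<^sub>1 \<simeq> pfs ((1 + z) # cs) (pfs [] (binary_qf 1 d))"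
          using isometric_trans [OF \<psi>(1) [unfolded a] dbl_mult_similarity [OF u [OF u0]]] by (simp add: P_def)
        have "\<psi>\<^sub>2 \<simeq> dbl z (pfs hs (P cs))"
          using isometric_trans [OF \<psi>(2) isometric_trans [OF hs(2) [unfolded w] dbl_mult_similarity [OF sim]]] .
        also have "\<dots> \<simeq> pfs (hs @ cs) (dbl z (binary_qf 1 d))"
          using isometric_sym [OF pfs_dbl_commute [OF binary_qf_carrier]] by (simp add: P_def flip: foldr_append)
        also have "\<dots> \<simeq> pfs (hs @ cs) (dbl (1 + z) (binary_qf 1 e))"
          unfolding e_def by (intro pfs_cong dbl_binary_shift z)
        also have "\<dots> \<simeq> dbl (1 + z) (pfs (hs @ cs) (binary_qf 1 e))"
          by (rule pfs_dbl_commute [OF binary_qf_carrier])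
        also have "\<dots> \<simeq> pfs ((1 + z) # cs) (pfs hs (binary_qf 1 e))"
          using swap by simp
        finally show "\<psi>\<^sub>2 \<simeq> pfs ((1 + z) # cs) (pfs hs (binary_qf 1 e))" .
      qed (use nz hs z in auto)
    qed
  qed
qed

end

theorem theorem4p1:
  fixes k m n :: nat and \<psi>\<^sub>1 \<psi>\<^sub>2 \<F>\<^sub>k :: "'a::field mat"
  assumes "CHAR('a) = 2"
    and "k \<ge> 1" and "m \<ge> 1" and "n \<ge> 1"
    and "quad_pfister (m + k) \<psi>\<^sub>1" and "quad_pfister (n + k) \<psi>\<^sub>2"
    and "separably_linked k \<psi>\<^sub>1 \<psi>\<^sub>2"
    and "is_k_invariant k \<psi>\<^sub>1 \<psi>\<^sub>2 \<F>\<^sub>k"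
  shows "(inseparably_linked k \<psi>\<^sub>1 \<psi>\<^sub>2 \<longrightarrow> hyperbolic \<F>\<^sub>k) \<and>
    (hyperbolic \<F>\<^sub>k \<and> (m = 1 \<or> n = 1) \<longrightarrow> inseparably_linked k \<psi>\<^sub>1 \<psi>\<^sub>2)"
proof -
  interpret char_two "TYPE('a)"
    by unfold_locales (rule assms(1))
  obtain as bs cs d where k: "k = Suc (length cs)"
    and nz: "0 \<notin> set as" "0 \<notin> set bs" "0 \<notin> set cs"
    and \<psi>\<^sub>1: "\<psi>\<^sub>1 \<simeq> pfs as (pfs cs (binary_qf 1 d))"
    and \<psi>\<^sub>2: "\<psi>\<^sub>2 \<simeq> pfs bs (pfs cs (binary_qf 1 d))"
    and \<F>: "\<F>\<^sub>k \<simeq> pfs as (pfs bs (pfs cs (binary_qf 1 d)))"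
    using assms(8) by (rule is_k_invariantE)
  let ?P = "pfs cs (binary_qf 1 d)"
  note P = pfs_carrier [OF binary_qf_carrier, of cs 1 d]
  have len: "length as = m" "length bs = n"
    using length_of_quad_pfister [OF assms(5) \<psi>\<^sub>1] length_of_quad_pfister [OF assms(6) \<psi>\<^sub>2] k by auto
  show ?thesis
  proof (intro conjI impI)
    assume "inseparably_linked k \<psi>\<^sub>1 \<psi>\<^sub>2"
    then obtain es fs gs d\<^sub>1 d\<^sub>2 where es: "length es = k"
      and *: "\<psi>\<^sub>1 \<simeq> pfs es (pfs fs (binary_qf 1 d\<^sub>1))" "\<psi>\<^sub>2 \<simeq> pfs es (pfs gs (binary_qf 1 d\<^sub>2))"
      by (rule inseparably_linkedE)
    have "isotropic (pfs as (pfs bs ?P))"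
      using inseparable_linkage_isotropic [OF nz(3), of es fs d\<^sub>1 as d gs d\<^sub>2 bs] es k
        isometric_imp_embeds [OF isometric_trans [OF isometric_sym [OF *(1)] \<psi>\<^sub>1]]
        isometric_imp_embeds [OF isometric_trans [OF isometric_sym [OF *(2)] \<psi>\<^sub>2]] by simp
    then have "hyperbolic (pfs as (pfs bs ?P))"
      using isotropic_pfs_imp_hyperbolic [of "as @ bs @ cs" d] nz by simp
    then show "hyperbolic \<F>\<^sub>k"
      using hyperbolic_cong [OF \<F>] by simp
  next
    assume *: "hyperbolic \<F>\<^sub>k \<and> (m = 1 \<or> n = 1)"
    have iso: "isotropic (pfs as (pfs bs ?P))"
      using * hyperbolic_cong [OF \<F>] by (intro hyperbolic_isotropic) auto
    from * show "inseparably_linked k \<psi>\<^sub>1 \<psi>\<^sub>2"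
    proof (elim conjE disjE)
      assume "m = 1"
      then obtain a where a: "as = [a]"
        using len by (auto simp: length_Suc_conv)
      show ?thesis
        unfolding k using nz a assms(4) len iso \<psi>\<^sub>1 \<psi>\<^sub>2
        by (intro inseparably_linked_of_isotropic [of a bs cs d]) auto
    next
      assume "n = 1"
      then obtain b where b: "bs = [b]"
        using len by (auto simp: length_Suc_conv)
      have "isotropic (pfs bs (pfs as ?P))"
        using embeds_isotropic [OF isometric_imp_embeds [OF pfs_commute [OF P]] iso] .
      then have "inseparably_linked (Suc (length cs)) \<psi>\<^sub>2 \<psi>\<^sub>1"
        using nz b assms(3) len \<psi>\<^sub>1 \<psi>\<^sub>2
        by (intro inseparably_linked_of_isotropic [of b as cs d]) auto
      then show ?thesis
        unfolding k by (rule inseparably_linked_sym)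
    qed
  qed
qed

end
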